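(* Let $\ell, k, n\in \mathbb N$ (positive integers) be such that $0<\ell \leq k/2$ and $k-\ell$ divides $n$. Then for any $2$-edge-colouring of the complete $k$-uniform hypergraph $\mathcal K_n^{(k)}$ on $n$ vertices, all the vertices of $\mathcal K_n^{(k)}$ can be covered with at most four vertex-disjoint monochromatic $\ell$-cycles; and if $\ell\leq k/3$, all the vertices can be covered with at most three vertex-disjoint monochromatic $\ell$-cycles.
   Context: $\mathcal K_n^{(k)}$ is the $k$-uniform hypergraph on $n$ vertices whose edges are all $k$-subsets of the vertex set; a $2$-edge-colouring assigns to each edge one of two colours (blue, red). An $\ell$-cycle is a $k$-uniform hypergraph with a cyclic ordering of its vertices and a cyclic ordering of its edges such that every edge consists of $k$ consecutive vertices and consecutive edges intersect in exactly $\ell$ vertices. Concretely, for $0<\ell\le k/2$ and $m\ge 3$, an $\ell$-cycle of length $m$ has $m(k-\ell)$ distinct vertices $v_0,\dots,v_{m(k-\ell)-1}$ and the $m$ edges $\{v_{i(k-\ell)},v_{i(k-\ell)+1},\dots,v_{i(k-\ell)+k-1}\}$, $0\le i<m$, indices modulo $m(k-\ell)$. By convention, two edges intersecting in exactly $2\ell$ vertices also form an $\ell$-cycle (of length two, with $2(k-\ell)$ vertices); when $\ell=k/2$ this means that a single edge, counted twice, is an $\ell$-cycle of length two. Also, any set of $k-\ell$ vertices counts as a (degenerate) $\ell$-cycle, with no edges. An $\ell$-cycle is monochromatic if all its edges have the same colour; a degenerate $\ell$-cycle is monochromatic. An $\ell$-cycle covers the vertices it contains. *)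

theory Defs
  imports Main "HOL-Library.Disjoint_Sets" "HOL-Library.Ramsey"
begin

datatype colour = Blue | Red

text \<open>A hypergraph is a pair of its vertex set and its edge set. The complete \<open>k\<close>-uniform
  hypergraph on \<open>V\<close> has edge set \<open>[V]\<^bsup>k\<^esup>\<close>.\<close>

type_synonym 'a hypergraph = "'a set \<times> 'a set set"

abbreviation verts :: "'a hypergraph \<Rightarrow> 'a set" where "verts \<equiv> fst"
abbreviation edges :: "'a hypergraph \<Rightarrow> 'a set set" where "edges \<equiv> snd"

definition complete_hypergraph :: "nat \<Rightarrow> 'a set \<Rightarrow> 'a hypergraph" where
  "complete_hypergraph k V = (V, [V]\<^bsup>k\<^esup>)"

definition subhypergraph :: "'a hypergraph \<Rightarrow> 'a hypergraph \<Rightarrow> bool" where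
  "subhypergraph H G \<longleftrightarrow> verts H \<subseteq> verts G \<and> edges H \<subseteq> edges G"

text \<open>The \<open>\<ell>\<close>-cycles in \<open>k\<close>-uniform hypergraphs, for \<open>0 < \<ell> \<le> k/2\<close>. In rule \<open>two\<close>, the case
  \<open>\<ell> = k/2\<close> forces \<open>e = f\<close>, so that a single edge is a cycle of length two.\<close>

inductive ell_cycle :: "nat \<Rightarrow> nat \<Rightarrow> 'a hypergraph \<Rightarrow> bool" for k l :: nat where
  degenerate: "finite W \<Longrightarrow> card W = k - l \<Longrightarrow> ell_cycle k l (W, {})"
| two: "e \<in> [UNIV]\<^bsup>k\<^esup> \<Longrightarrow> f \<in> [UNIV]\<^bsup>k\<^esup> \<Longrightarrow> card (e \<inter> f) = 2 * l \<Longrightarrow>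
    ell_cycle k l (e \<union> f, {e, f})"
| long: "m \<ge> 3 \<Longrightarrow> inj_on v {..<m * (k - l)} \<Longrightarrow>
    ell_cycle k l
      (v ` {..<m * (k - l)},
       {{v ((i * (k - l) + j) mod (m * (k - l))) | j. j < k} | i. i < m})"

definition monochromatic :: "('a set \<Rightarrow> colour) \<Rightarrow> 'a hypergraph \<Rightarrow> bool" where
  "monochromatic c H \<longleftrightarrow> (\<exists>col. \<forall>e\<in>edges H. c e = col)"

text \<open>The vertices of the complete \<open>k\<close>-uniform hypergraph on \<open>V\<close> can be covered with at most \<open>t\<close>
  vertex-disjoint monochromatic \<open>\<ell>\<close>-cycles contained in it. The colouring is a total function on
  sets, but only its values on edges are used.\<close>

definition mono_cycle_coverable ::
    "nat \<Rightarrow> nat \<Rightarrow> 'a set \<Rightarrow> ('a set \<Rightarrow> colour) \<Rightarrow> nat \<Rightarrow> bool" where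
  "mono_cycle_coverable k l V c t \<longleftrightarrow>
     (\<exists>\<C> :: 'a hypergraph set. finite \<C> \<and> card \<C> \<le> t \<and>
        (\<forall>C\<in>\<C>. ell_cycle k l C \<and> subhypergraph C (complete_hypergraph k V) \<and> monochromatic c C) \<and>
        disjoint_family_on verts \<C> \<and>
        (\<Union>C\<in>\<C>. verts C) = V)"

end

theory Submission
  imports Defs "HOL-Library.Multiset"
begin

text \<open>Call \<open>k - l\<close> vertices a unit. Two units always span a monochromatic cycle of length two, since
  a two-colouring of a Kneser graph with an odd cycle has a monochromatic edge. So it suffices to find
  two disjoint monochromatic cycles missing at most two units.

  Zigzagging in the style of Gerencser and Gyarfas gives a red cycle \<open>C\<close> and a blue path \<open>P\<close> that
  together miss one unit; take \<open>C\<close> as long as possible. If \<open>P\<close> cannot be closed up, even after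
  dropping one more unit, then its ends are joined in red, so an end of \<open>P\<close> that is joined in red to
  a vertex block of \<open>C\<close> is joined in blue to the neighbouring blocks: otherwise \<open>C\<close> could be extended.
  Now extend \<open>P\<close> by a block of \<open>C\<close> and let the blue path eat the remaining red path alternately from
  both ends, until the rest closes up to a red cycle. If the blue path cannot be closed up at that
  moment, its last two blocks and the first block of \<open>P\<close> form a red detour that is added to the red
  cycle, and the blue path without these three blocks can be closed up.\<close>

section \<open>The setting, and cycles of length at most two\<close>

lemma div_mod_block:
  fixes t :: nat
  assumes "j < t" shows "(i * t + j) div t = i" "(i * t + j) mod t = j"
  using assms by auto

lemma colour_neq: "x \<noteq> z \<Longrightarrow> y \<noteq> z \<Longrightarrow> x = y" for x y z :: colour
  by (cases x; cases y; cases z) auto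

locale cover_setup =
  fixes l r N :: nat and V :: "'a set" and c :: "'a set \<Rightarrow> colour"
  assumes l_pos: "0 < l" and finite_V: "finite V" and card_V: "card V = N * (l + r)"
begin

abbreviation s :: nat where "s \<equiv> l + r"
abbreviation k :: nat where "k \<equiv> 2 * l + r"

lemma k_minus_l: "k - l = s"
  by simp

definition mono_cycle :: "'a set \<Rightarrow> bool" where
  "mono_cycle X \<longleftrightarrow> (\<exists>H. ell_cycle k l H \<and> monochromatic c H \<and> verts H = X)"

lemma mono_cycle_degenerate:
  assumes "finite X" "card X = s" shows "mono_cycle X"
  using degenerate[of X k l] assms unfolding mono_cycle_def monochromatic_def k_minus_l by force

lemma mono_cycle_two:
  assumes "finite e" "finite f" "card e = k" "card f = k" "card (e \<inter> f) = 2 * l" "c e = c f"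
  shows "mono_cycle (e \<union> f)"
  using two[of e k f l] assms unfolding mono_cycle_def monochromatic_def nsets_def by force

text \<open>The complements of two disjoint \<open>r\<close>-subsets of \<open>U\<close> meet in \<open>2 * l\<close> vertices. If no such pair had
  complements of equal colour, exchanging one element would not change the colour of the complement,
  because some \<open>r\<close>-set is disjoint from both \<open>r\<close>-sets.\<close>

lemma mono_cycle_double_unit:
  assumes "finite U" "card U = 2 * s" shows "mono_cycle U"
proof (rule ccontr)
  assume neg: "\<not> mono_cycle U"
  have diff: "c (U - S) \<noteq> c (U - T)"
    if "S \<subseteq> U" "T \<subseteq> U" "card S = r" "card T = r" "S \<inter> T = {}" for S T
  proof
    assume eq: "c (U - S) = c (U - T)"
    have fin: "finite S" "finite T" using that assms by (auto intro: finite_subset)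
    have "(U - S) \<inter> (U - T) = U - (S \<union> T)" by auto
    then have "card ((U - S) \<inter> (U - T)) = card (U - (S \<union> T))" by (rule arg_cong)
    also have "card (U - (S \<union> T)) = card U - card (S \<union> T)"
      using that fin by (intro card_Diff_subset) auto
    also have "\<dots> = 2 * l" using that fin assms(2) by (simp add: card_Un_disjoint)
    finally have "card ((U - S) \<inter> (U - T)) = 2 * l" .
    moreover have "card (U - S) = k" "card (U - T) = k"
      using that fin assms by (simp_all add: card_Diff_subset)
    moreover have "(U - S) \<union> (U - T) = U" using that by auto
    ultimately show False
      using mono_cycle_two[of "U - S" "U - T"] eq neg assms by auto
  qed
  have swap: "c (U - S) = c (U - insert b (S - {a}))"
    if "S \<subseteq> U" "card S = r" "a \<in> S" "b \<in> U" "b \<notin> S" for S a b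
  proof -
    have fin: "finite S" using that assms by (auto intro: finite_subset)
    have "card (U - insert b S) = 2 * s - Suc r"
      using that fin assms by (simp add: card_Diff_subset)
    \<comment> \<open>The difference \<open>2 * s - Suc r\<close> equals \<open>k - 1\<close>, which
      is at least \<open>r\<close> because \<open>l\<close> is positive.\<close>
    then have "r \<le> card (U - insert b S)" using l_pos by simp
    then obtain T where T: "T \<subseteq> U - insert b S" "card T = r"
      by (meson obtain_subset_with_card_n)
    have "card (insert b (S - {a})) = r"
      using that fin card_Suc_Diff1[of S a] by simp
    then have "c (U - insert b (S - {a})) \<noteq> c (U - T)"
      using that T by (intro diff) auto
    moreover have "c (U - S) \<noteq> c (U - T)" using that T by (intro diff) auto
    ultimately show ?thesis using colour_neq by metis
  qed
  have same: "c (U - S) = c (U - T)"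
    if "S \<subseteq> U" "T \<subseteq> U" "card S = r" "card T = r" for S T
    using that
  proof (induction "card (S - T)" arbitrary: S)
    case 0
    have "finite S" "finite T" using 0 assms by (auto intro: finite_subset)
    then have "S = T" using 0 by (simp add: card_subset_eq)
    then show ?case by simp
  next
    case (Suc n)
    have fin: "finite S" "finite T" using Suc assms by (auto intro: finite_subset)
    have "S - T \<noteq> {}" using Suc.hyps(2) by force
    then obtain a where a: "a \<in> S - T" by blast
    have "\<not> T \<subseteq> S" using a card_subset_eq[OF fin(1), of T] Suc.prems by auto
    then obtain b where b: "b \<in> T - S" by auto
    let ?S = "insert b (S - {a})"
    have "?S - T = (S - T) - {a}" using b by auto
    then have "n = card (?S - T)" using Suc.hyps(2) a fin by simp
    moreover have "card ?S = r"
      using a b fin Suc.prems card_Suc_Diff1[of S a] by simp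
    ultimately have "c (U - ?S) = c (U - T)"
      using Suc.hyps(1)[of ?S] Suc.prems b by auto
    then show ?case using swap[of S a b] a b Suc.prems by auto
  qed
  have "r \<le> card U" using assms by simp
  then obtain S where S: "S \<subseteq> U" "card S = r" by (meson obtain_subset_with_card_n)
  have "finite S" using S assms by (auto intro: finite_subset)
  then have "r \<le> card (U - S)" using S assms by (simp add: card_Diff_subset)
  then obtain T where T: "T \<subseteq> U - S" "card T = r" by (meson obtain_subset_with_card_n)
  have "T \<subseteq> U" "S \<inter> T = {}" using T by auto
  then show False using diff[of S T] same[of S T] S T by auto
qed

lemma inj_shift_mod:
  fixes a n :: nat
  assumes "k \<le> n" shows "inj_on (\<lambda>j. (a + j) mod n) {..<k}"
proof (rule inj_onI)
  fix i j assume ij: "i \<in> {..<k}" "j \<in> {..<k}" and "(a + i) mod n = (a + j) mod n"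
  then obtain q q' where "a + i + n * q = a + j + n * q'" by (metis nat_mod_eq_iff)
  then have "i + n * q = j + n * q'" by simp
  then have "(i + n * q) mod n = (j + n * q') mod n" by simp
  then show "i = j" using ij assms by simp
qed

text \<open>In a long cycle a window of \<open>k\<close> positions does not wrap onto itself, as
  \<open>k \<le> 2 * (k - l) \<le> m * (k - l)\<close>. This is what places a cycle inside the
  complete hypergraph.\<close>

lemma ell_cycle_edges:
  assumes "ell_cycle k l H" shows "edges H \<subseteq> [verts H]\<^bsup>k\<^esup>"
  using assms
proof cases
  case (long m v)
  have km: "k \<le> m * (k - l)"
  proof -
    have "k \<le> 2 * (k - l)" by simp
    also have "\<dots> \<le> m * (k - l)" using long(2) by (intro mult_right_mono) auto
    finally show ?thesis .
  qed
  then have pos: "0 < m * (k - l)" using l_pos by linarith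
  show ?thesis
  proof
    fix e assume "e \<in> edges H"
    then obtain i where e: "e = v ` ((\<lambda>j. (i * (k - l) + j) mod (m * (k - l))) ` {..<k})"
      unfolding long(1) by auto
    let ?J = "(\<lambda>j. (i * (k - l) + j) mod (m * (k - l))) ` {..<k}"
    have J: "?J \<subseteq> {..<m * (k - l)}" using pos by auto
    have "card e = card ?J" unfolding e using long(3) J by (meson card_image inj_on_subset)
    also have "\<dots> = k" using inj_shift_mod[OF km] by (simp add: card_image)
    finally have "card e = k" .
    then show "e \<in> [verts H]\<^bsup>k\<^esup>" unfolding nsets_def long(1) using e J by auto
  qed
qed (auto simp: nsets_def)

section \<open>Covers by disjoint monochromatic cycles\<close>

definition covers :: "nat \<Rightarrow> 'a set \<Rightarrow> bool" where
  "covers t U \<longleftrightarrow> (\<exists>F. finite F \<and> card F \<le> t \<and> (\<forall>X\<in>F. mono_cycle X) \<and> disjoint F \<and> \<Union>F = U)"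

lemma covers_mono: "covers t U \<Longrightarrow> t \<le> t' \<Longrightarrow> covers t' U"
  unfolding covers_def by (elim exE conjE, rule exI, intro conjI) (assumption | simp)+

lemma covers_empty: "covers t {}"
  unfolding covers_def by (rule exI[of _ "{}"]) auto

lemma covers_mono_cycle: "mono_cycle X \<Longrightarrow> covers 1 X"
  unfolding covers_def by (rule exI[of _ "{X}"]) auto

lemma covers_Un:
  assumes "covers t U" "covers t' U'" "U \<inter> U' = {}"
  shows "covers (t + t') (U \<union> U')"
proof -
  obtain F where F: "finite F" "card F \<le> t" "\<forall>X\<in>F. mono_cycle X" "disjoint F" "\<Union>F = U"
    using assms(1) unfolding covers_def by auto
  obtain F' where F': "finite F'" "card F' \<le> t'" "\<forall>X\<in>F'. mono_cycle X" "disjoint F'" "\<Union>F' = U'"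
    using assms(2) unfolding covers_def by auto
  have "card (F \<union> F') \<le> t + t'" using F(2) F'(2) card_Un_le[of F F'] by linarith
  moreover have "disjoint (F \<union> F')" using F F' assms(3) by (intro disjoint_union) auto
  ultimately show ?thesis
    unfolding covers_def using F F' by (intro exI[of _ "F \<union> F'"]) auto
qed

lemma covers_le_two_units:
  assumes "U \<subseteq> V" "card U = j * s" "j \<le> 2" shows "covers 1 U"
proof -
  have fin: "finite U" using assms(1) finite_V finite_subset by auto
  consider "j = 0" | "j = 1" | "j = 2" using assms(3) by linarith
  then show ?thesis
  proof cases
    case 1
    then have "U = {}" using fin assms(2) by simp
    then show ?thesis by (simp add: covers_empty)
  next
    case 2
    then have "card U = s" using assms(2) by simp
    then show ?thesis using fin by (intro covers_mono_cycle mono_cycle_degenerate)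
  next
    case 3
    then have "card U = 2 * s" using assms(2) by simp
    then show ?thesis using fin by (intro covers_mono_cycle mono_cycle_double_unit)
  qed
qed

lemma covers_le_four_units:
  assumes "U \<subseteq> V" "card U = j * s" "j \<le> 4" shows "covers 2 U"
proof -
  have "min j 2 * s \<le> card U" unfolding assms(2) by (rule mult_le_mono1) simp
  then obtain T where T: "T \<subseteq> U" "card T = min j 2 * s" by (meson obtain_subset_with_card_n)
  have "T \<subseteq> V" using T assms by blast
  then have "finite T" using finite_V finite_subset by blast
  then have "card (U - T) = (j - min j 2) * s"
    using T assms(2) by (simp add: card_Diff_subset diff_mult_distrib)
  then have "covers 1 (U - T)" using assms by (intro covers_le_two_units) auto
  moreover have "covers 1 T" using T assms by (intro covers_le_two_units[of _ "min j 2"]) auto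
  ultimately have "covers (1 + 1) (T \<union> (U - T))" by (intro covers_Un) auto
  then show ?thesis using T by (simp add: Un_absorb1 numeral_2_eq_2)
qed

lemma coverable_if_covers:
  assumes "covers t V" shows "mono_cycle_coverable k l V c t"
proof -
  obtain F where F: "finite F" "card F \<le> t" "\<forall>X\<in>F. mono_cycle X" "disjoint F" "\<Union>F = V"
    using assms unfolding covers_def by auto
  have "\<forall>X\<in>F. \<exists>H. ell_cycle k l H \<and> monochromatic c H \<and> verts H = X"
    using F(3) by (simp add: mono_cycle_def)
  from bchoice[OF this] obtain h
    where h: "\<forall>X\<in>F. ell_cycle k l (h X) \<and> monochromatic c (h X) \<and> verts (h X) = X" by blast
  have "subhypergraph (h X) (complete_hypergraph k V)" if "X \<in> F" for X
  proof -
    have "edges (h X) \<subseteq> [X]\<^bsup>k\<^esup>" using ell_cycle_edges[of "h X"] h that by simp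
    moreover have "X \<subseteq> V" using F(5) that by blast
    moreover have "[X]\<^bsup>k\<^esup> \<subseteq> [V]\<^bsup>k\<^esup>" using \<open>X \<subseteq> V\<close> by (rule nsets_mono)
    ultimately show ?thesis
      using h that unfolding subhypergraph_def complete_hypergraph_def by auto
  qed
  moreover have "card (h ` F) \<le> t" using F(1,2) card_image_le le_trans by blast
  moreover have "disjoint_family_on verts (h ` F)"
    unfolding disjoint_family_on_def
  proof (intro ballI impI)
    fix C D assume "C \<in> h ` F" "D \<in> h ` F" "C \<noteq> D"
    then obtain X Y where "X \<in> F" "Y \<in> F" "X \<noteq> Y" "C = h X" "D = h Y" by blast
    then show "verts C \<inter> verts D = {}" using disjointD[OF F(4), of X Y] h by simp
  qed
  moreover have "(\<Union>C\<in>h ` F. verts C) = V" using h F(5) by auto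
  ultimately show ?thesis
    unfolding mono_cycle_coverable_def using F(1) h by (intro exI[of _ "h ` F"]) auto
qed

subsection \<open>Block paths and block cycles\<close>

text \<open>Blocks form a multiset because for \<open>r = 0\<close> all middle blocks are empty and
  the empty block occurs repeatedly; a nonempty block can occur only once in a packing.\<close>

definition packing :: "'a set multiset \<Rightarrow> bool" where
  "packing bl \<longleftrightarrow> (\<forall>X\<in>#bl. X \<subseteq> V \<and> (\<forall>Y\<in>#bl - {#X#}. X \<inter> Y = {}))"

definition support :: "'a set multiset \<Rightarrow> 'a set" where
  "support bl = \<Union>(set_mset bl)"

lemma support_simps [simp]: "support {#} = {}" "support (add_mset X bl) = X \<union> support bl" "support (A + B) = support A \<union> support B"
  by (auto simp: support_def)

lemma packing_mono: "packing B \<Longrightarrow> A \<subseteq># B \<Longrightarrow> packing A"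
  unfolding packing_def
proof (intro ballI conjI)
  fix X assume B: "\<forall>X\<in>#B. X \<subseteq> V \<and> (\<forall>Y\<in>#B - {#X#}. X \<inter> Y = {})" and "A \<subseteq># B" and X: "X \<in># A"
  then show "X \<subseteq> V" using mset_subset_eqD by metis
  fix Y assume Y: "Y \<in># A - {#X#}"
  have "A - {#X#} \<subseteq># B - {#X#}"
    using \<open>A \<subseteq># B\<close> by (simp add: subseteq_mset_def diff_le_mono)
  then have "Y \<in># B - {#X#}" using Y mset_subset_eqD by metis
  moreover have "X \<in># B" using \<open>A \<subseteq># B\<close> X mset_subset_eqD by metis
  ultimately show "X \<inter> Y = {}" using B by blast
qed

lemma packing_empty [simp]: "packing {#}"
  by (simp add: packing_def)

lemma packing_add: "packing (add_mset X bl) \<longleftrightarrow> X \<subseteq> V \<and> X \<inter> support bl = {} \<and> packing bl"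
proof
  assume packing: "packing (add_mset X bl)"
  then have "X \<subseteq> V \<and> (\<forall>Y\<in>#bl. X \<inter> Y = {})" unfolding packing_def by force
  then show "X \<subseteq> V \<and> X \<inter> support bl = {} \<and> packing bl"
    using packing_mono[OF packing, of bl] by (auto simp: support_def)
next
  assume *: "X \<subseteq> V \<and> X \<inter> support bl = {} \<and> packing bl"
  show "packing (add_mset X bl)"
    unfolding packing_def
  proof (intro ballI conjI)
    fix Y assume Y: "Y \<in># add_mset X bl"
    then show "Y \<subseteq> V" using * by (auto simp: packing_def)
    fix Z assume Z: "Z \<in># add_mset X bl - {#Y#}"
    show "Y \<inter> Z = {}"
    proof (cases "Y = X")
      case True then show ?thesis using Z * by (auto simp: support_def)
    next
      case False
      then have Yb: "Y \<in># bl" using Y by simp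
      have "Z = X \<or> Z \<in># bl - {#Y#}" using False Z by (simp split: if_splits)
      then show ?thesis
      proof
        assume "Z = X" then show ?thesis using * Yb by (auto simp: support_def)
      next
        assume "Z \<in># bl - {#Y#}" then show ?thesis using * Yb by (auto simp: packing_def)
      qed
    qed
  qed
qed

lemma packing_support: "packing bl \<Longrightarrow> support bl \<subseteq> V"
  by (auto simp: packing_def support_def)

lemma packing_disjoint: "packing (A + B) \<Longrightarrow> support A \<inter> support B = {}"
  by (induction A) (auto simp: packing_add)

lemma finite_support: "packing bl \<Longrightarrow> finite (support bl)"
  using packing_support finite_V finite_subset by blast

lemma card_support: "packing bl \<Longrightarrow> card (support bl) = (\<Sum>X\<in>#bl. card X)"
proof (induction bl)
  case (add X bl)
  then have "X \<subseteq> V" "X \<inter> support bl = {}" "packing bl" by (auto simp: packing_add)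
  moreover have "finite X" using calculation(1) finite_V by (rule finite_subset)
  ultimately show ?case using add.IH finite_support[of bl] by (simp add: card_Un_disjoint)
qed simp

text \<open>Edges of a path are cut into blocks \<open>x \<union> m \<union> y\<close>, where \<open>x\<close> and \<open>y\<close> are the \<open>l\<close>-sets shared with the
  neighbouring edges and \<open>m\<close> has the remaining \<open>r\<close> vertices. In \<open>path E n x bl y\<close> the number \<open>n\<close> counts
  the \<open>l\<close>-blocks, and \<open>bl\<close> collects all blocks; they are disjoint only if \<open>packing bl\<close> holds.\<close>

definition edge :: "colour \<Rightarrow> 'a set \<Rightarrow> 'a set \<Rightarrow> 'a set \<Rightarrow> bool" where
  "edge col x m y \<longleftrightarrow> card m = r \<and> c (x \<union> m \<union> y) = col"

lemma edge_sym: "edge col x m y \<Longrightarrow> edge col y m x"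
  by (simp add: edge_def Un_ac)

lemma edge_Blue: "\<not> edge Red x m y \<Longrightarrow> card m = r \<Longrightarrow> edge Blue x m y"
  using colour.exhaust by (auto simp: edge_def)

lemma edge_Red: "\<not> edge Blue x m y \<Longrightarrow> card m = r \<Longrightarrow> edge Red x m y"
  using colour.exhaust by (auto simp: edge_def)

lemma edge_card: "edge col x m y \<Longrightarrow> card m = r"
  by (simp add: edge_def)

inductive path :: "('a set \<Rightarrow> 'a set \<Rightarrow> 'a set \<Rightarrow> bool) \<Rightarrow> nat \<Rightarrow> 'a set \<Rightarrow> 'a set multiset \<Rightarrow> 'a set \<Rightarrow> bool"
  for E where
  single: "card x = l \<Longrightarrow> path E (Suc 0) x {#x#} x"
| step: "card x = l \<Longrightarrow> E x m y \<Longrightarrow> path E n y bl z \<Longrightarrow> path E (Suc n) x (add_mset x (add_mset m bl)) z"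

lemma path_pos: "path E n x bl y \<Longrightarrow> 0 < n"
  by (induction rule: path.induct) auto

lemma path_append:
  assumes "path E n x bl y" "E y m z" "path E n' z bl' w"
  shows "path E (n + n') x (bl + bl' + {#m#}) w"
  using assms
proof (induction rule: path.induct)
  case (single x)
  then show ?case using path.step[of x E m z n' bl' w] by (simp add: add_mset_commute)
next
  case (step x m' y n bl z)
  then show ?case using path.step[OF step.hyps(1,2) step.IH[OF step.prems]] by (simp add: add_mset_commute)
qed

lemma path_snoc:
  assumes "path E n x bl y" "E y m z" "card z = l"
  shows "path E (Suc n) x (add_mset z (add_mset m bl)) z"
  using path_append[OF assms(1,2) path.single[OF assms(3)]] by (simp add: add_mset_commute)

lemma path_rev:
  assumes sym: "\<And>x m y. E x m y \<Longrightarrow> E y m x" and "path E n x bl y"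
  shows "path E n y bl x"
  using assms(2)
proof (induction rule: path.induct)
  case (step x m y n bl z)
  then show ?case using path_snoc[OF step.IH sym[OF step.hyps(2)] step.hyps(1)] by simp
qed (rule path.single)

lemma edge_path_rev: "path (edge col) n x bl y \<Longrightarrow> path (edge col) n y bl x"
  by (rule path_rev[OF edge_sym])

lemma path_mono:
  assumes "\<And>x m y. E x m y \<Longrightarrow> E' x m y" "path E n x bl y"
  shows "path E' n x bl y"
  using assms(2)
proof induction
  case (step x m y n bl z)
  then show ?case by (intro path.step assms(1))
qed (rule path.single)

lemma path_peel:
  assumes "path E n x bl y" "n \<noteq> 1"
  obtains m z bl' n' where "n = Suc n'" "0 < n'" "E x m z" "path E n' z bl' y" "bl = add_mset x (add_mset m bl')"
    "card x = l"
  using assms by (cases rule: path.cases) (auto dest: path_pos)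

lemma path_one: "path E (Suc 0) x bl y \<longleftrightarrow> y = x \<and> bl = {#x#} \<and> card x = l"
proof
  assume "path E (Suc 0) x bl y"
  then show "y = x \<and> bl = {#x#} \<and> card x = l" by cases (use path_pos in force)+
qed (simp add: path.single)

lemma path_start: "path E n x bl y \<Longrightarrow> card x = l \<and> x \<in># bl"
  by (auto elim: path.cases)

lemma path_end: "path E n x bl y \<Longrightarrow> card y = l \<and> y \<in># bl"
  by (induction rule: path.induct) auto

text \<open>A path has one \<open>r\<close>-block fewer than \<open>l\<close>-blocks; the summand
  \<open>r\<close> makes up for the missing one.\<close>

lemma path_sum:
  assumes "\<And>x m y. E x m y \<Longrightarrow> card m = r" "path E n x bl y"
  shows "(\<Sum>X\<in>#bl. card X) + r = n * s"
  using assms(2) by induction (auto simp: assms(1))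

text \<open>For \<open>n = 1\<close> this is the degenerate cycle, whose blocks form no edge.\<close>

definition closed :: "colour \<Rightarrow> nat \<Rightarrow> 'a set multiset \<Rightarrow> bool" where
  "closed col n bl \<longleftrightarrow> (\<exists>x y m bl'. path (edge col) n x bl' y \<and> card m = r \<and>
     (n = 1 \<or> edge col y m x) \<and> bl = add_mset m bl')"

lemma closedI: "path (edge col) n x bl y \<Longrightarrow> edge col y m x \<Longrightarrow> closed col n (add_mset m bl)"
  unfolding closed_def using edge_card by blast

lemma card_closed: "closed col n bl \<Longrightarrow> packing bl \<Longrightarrow> card (support bl) = n * s"
  using path_sum[of "edge col"] edge_card by (fastforce simp: closed_def card_support)

section \<open>From block cycles to hypergraph cycles\<close>

lemma path_functions:
  assumes "path E n x bl y"
  obtains Lf Mf where "Lf 0 = x" "Lf (n - 1) = y" "\<And>i. Suc i < n \<Longrightarrow> E (Lf i) (Mf i) (Lf (Suc i))"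
    "\<And>i. i < n \<Longrightarrow> card (Lf i) = l" "support bl = (\<Union>i<n. Lf i) \<union> (\<Union>i<n - 1. Mf i)"
proof -
  have "\<exists>Lf Mf. Lf 0 = x \<and> Lf (n - 1) = y \<and> (\<forall>i. Suc i < n \<longrightarrow> E (Lf i) (Mf i) (Lf (Suc i))) \<and>
      (\<forall>i<n. card (Lf i) = l) \<and> support bl = (\<Union>i<n. Lf i) \<union> (\<Union>i<n - 1. Mf i)"
    using assms
  proof (induction rule: path.induct)
    case (single x)
    then show ?case by (intro exI[of _ "\<lambda>_. x"]) auto
  next
    case (step x m y n bl z)
    then obtain Lf Mf where f: "Lf 0 = y" "Lf (n - 1) = z"
      "\<forall>i. Suc i < n \<longrightarrow> E (Lf i) (Mf i) (Lf (Suc i))"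
      "\<forall>i<n. card (Lf i) = l" "support bl = (\<Union>i<n. Lf i) \<union> (\<Union>i<n - 1. Mf i)" by blast
    obtain n' where n': "n = Suc n'" using path_pos[OF step.hyps(3)] by (cases n) auto
    let ?L = "case_nat x Lf" and ?M = "case_nat m Mf"
    have "?L 0 = x" "?L (Suc n - 1) = z" using f(2) n' by auto
    moreover have "\<forall>i. Suc i < Suc n \<longrightarrow> E (?L i) (?M i) (?L (Suc i))"
      using f(1,3) step.hyps(2) by (auto split: nat.split)
    moreover have "\<forall>i<Suc n. card (?L i) = l"
      using f(4) step.hyps(1) by (auto split: nat.split)
    moreover have "(\<Union>i<Suc j. case_nat a F i) = a \<union> (\<Union>i<j. F i)" for j and a :: "'a set" and F
      by (simp only: lessThan_Suc_eq_insert_0) auto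
    then have "support (add_mset x (add_mset m bl)) = (\<Union>i<Suc n. ?L i) \<union> (\<Union>i<Suc n - 1. ?M i)"
      using f(5) n' by auto
    ultimately show ?case by blast
  qed
  then show thesis using that by blast
qed

text \<open>Each list is meant to enumerate an \<open>l\<close>-block followed by an
  \<open>r\<close>-block. As \<open>k = s + l\<close>, the window starting at position
  \<open>i * s\<close> takes the whole list \<open>b i\<close> and the \<open>l\<close>-block of the
  next one.\<close>

lemma cyclic_window:
  fixes b :: "nat \<Rightarrow> 'a list"
  assumes n: "2 \<le> n" and len: "\<And>i. i < n \<Longrightarrow> length (b i) = s" and i: "i < n"
  defines "v \<equiv> \<lambda>q. b (q div s) ! (q mod s)"
  shows "{v ((i * s + j) mod (n * s)) | j. j < k} = set (b i) \<union> set (take l (b (Suc i mod n)))"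
proof -
  have s0: "0 < s" using l_pos by simp
  have first: "v ((i * s + j) mod (n * s)) = b i ! j" if "j < s" for j
  proof -
    have "i * s + j < Suc i * s" using that by simp
    also have "\<dots> \<le> n * s" using i by (intro mult_right_mono) auto
    finally have "(i * s + j) mod (n * s) = i * s + j" by simp
    moreover have "(i * s + j) div s = i" "(i * s + j) mod s = j"
      using that by (rule div_mod_block)+
    ultimately show ?thesis by (simp only: v_def)
  qed
  have second: "v ((i * s + (s + j)) mod (n * s)) = b (Suc i mod n) ! j" if "j < l" for j
  proof -
    have js: "j < s" using that by simp
    have "i * s + (s + j) = Suc i * s + j" by (simp add: algebra_simps)
    also have "\<dots> mod (n * s) = (Suc i mod n) * s + j"
    proof (cases "Suc i = n")
      case True
      have "s \<le> n * s" using n by simp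
      then have "j < n * s" using js by linarith
      then show ?thesis using True by simp
    next
      case False
      have "Suc i * s + j < Suc (Suc i) * s" using js by simp
      also have "\<dots> \<le> n * s" using i False by (intro mult_right_mono) auto
      finally show ?thesis using i False by simp
    qed
    finally have *: "(i * s + (s + j)) mod (n * s) = (Suc i mod n) * s + j" .
    have "((Suc i mod n) * s + j) div s = Suc i mod n" "((Suc i mod n) * s + j) mod s = j"
      using js by (rule div_mod_block)+
    then show ?thesis by (simp only: v_def *)
  qed
  have "{..<k} = {..<s} \<union> (+) s ` {..<l}"
  proof -
    have "j \<in> (+) s ` {..<l}" if "j < k" "\<not> j < s" for j
      using that by (intro image_eqI[of _ _ "j - s"]) auto
    then show ?thesis by auto
  qed
  then have "{v ((i * s + j) mod (n * s)) | j. j < k} =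
      (\<lambda>j. v ((i * s + j) mod (n * s))) ` {..<s} \<union> (\<lambda>j. v ((i * s + (s + j)) mod (n * s))) ` {..<l}"
    by (simp only: setcompr_eq_image lessThan_def[symmetric] image_Un image_image)
  also have "\<dots> = (\<lambda>j. b i ! j) ` {..<s} \<union> (\<lambda>j. b (Suc i mod n) ! j) ` {..<l}"
    using first second by (intro arg_cong2[of _ _ _ _ "(\<union>)"] image_cong) auto
  also have "(\<lambda>j. b i ! j) ` {..<s} = set (b i)"
    using len[OF i] by (auto simp: set_conv_nth)
  also have "(\<lambda>j. b (Suc i mod n) ! j) ` {..<l} = set (take l (b (Suc i mod n)))"
    using len[of "Suc i mod n"] n nth_image[of l "b (Suc i mod n)"] by (simp add: atLeast0LessThan)
  finally show ?thesis .
qed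

lemma mono_cycle_long:
  assumes n: "3 \<le> n" and card: "card U = n * s"
    and b: "\<And>i. i < n \<Longrightarrow> length (b i) = s" and U: "U = (\<Union>i<n. set (b i))"
    and mono: "\<And>i. i < n \<Longrightarrow> c (set (b i) \<union> set (take l (b (Suc i mod n)))) = col"
  shows "mono_cycle U"
proof -
  let ?v = "\<lambda>q. b (q div s) ! (q mod s)"
  have s0: "0 < s" using l_pos by simp
  have img: "?v ` {..<n * s} = U"
  proof
    show "?v ` {..<n * s} \<subseteq> U"
    proof
      fix a assume "a \<in> ?v ` {..<n * s}"
      then obtain q where q: "q < n * s" "a = ?v q" by auto
      then have "q div s < n" by (simp add: less_mult_imp_div_less)
      moreover have "q mod s < s" using s0 by (rule mod_less_divisor)
      ultimately show "a \<in> U" unfolding U q(2) using b by (intro UN_I[of "q div s"]) auto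
    qed
    show "U \<subseteq> ?v ` {..<n * s}"
    proof
      fix a assume "a \<in> U"
      then obtain i where i: "i < n" "a \<in> set (b i)" unfolding U by auto
      then obtain j where j: "j < s" "a = b i ! j" using b by (metis in_set_conv_nth)
      have "i * s + j < Suc i * s" using j by simp
      also have "\<dots> \<le> n * s" using i by (intro mult_right_mono) auto
      finally have "i * s + j \<in> {..<n * s}" by simp
      moreover have "(i * s + j) div s = i" "(i * s + j) mod s = j"
        using j(1) by (rule div_mod_block)+
      ultimately show "a \<in> ?v ` {..<n * s}" using j(2) by (intro image_eqI[of _ _ "i * s + j"]) simp_all
    qed
  qed
  \<comment> \<open>A map from \<open>n * s\<close> positions onto a set of \<open>n * s\<close>
    vertices is injective; disjointness of the lists enters only through this count.\<close>
  have inj: "inj_on ?v {..<n * s}" using img card by (intro eq_card_imp_inj_on) simp_all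
  define W where "W i = {?v ((i * s + j) mod (n * s)) | j. j < k}" for i
  from long[of n ?v k l, unfolded k_minus_l, OF n inj]
  have "ell_cycle k l (U, {W i | i. i < n})" by (simp only: img W_def)
  moreover have "c (W i) = col" if "i < n" for i
  proof -
    have "W i = set (b i) \<union> set (take l (b (Suc i mod n)))"
      unfolding W_def using n that b by (intro cyclic_window) auto
    then show ?thesis using mono[OF that] by simp
  qed
  then have "monochromatic c (U, {W i | i. i < n})" unfolding monochromatic_def by auto
  ultimately show ?thesis unfolding mono_cycle_def by (intro exI[of _ "(U, {W i | i. i < n})"]) simp
qed

text \<open>For \<open>n = 2\<close> the two edges share both \<open>l\<close>-blocks and differ in
  their \<open>r\<close>-blocks, so they meet in \<open>2 * l\<close> vertices (for
  \<open>r = 0\<close> they coincide). From \<open>n = 3\<close> on, the blocks are listed in cyclic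
  order and give a long cycle.\<close>

lemma mono_cycle_closed:
  assumes cl: "closed col n bl" and packing: "packing bl" shows "mono_cycle (support bl)"
proof -
  obtain x y m bl' where p: "path (edge col) n x bl' y" "card m = r"
    "n = 1 \<or> edge col y m x" "bl = add_mset m bl'"
    using cl unfolding closed_def by blast
  have fin: "finite (support bl)" and card: "card (support bl) = n * s"
    using finite_support[OF packing] card_closed[OF cl packing] by auto
  consider "n = 1" | "n = 2" | "3 \<le> n" using path_pos[OF p(1)] by linarith
  then show ?thesis
  proof cases
    case 1
    then show ?thesis using fin card by (intro mono_cycle_degenerate) auto
  next
    case 2
    then obtain m' where m': "edge col x m' y" "bl' = {#x, m', y#}" "card x = l" "card y = l"
      using p(1) by (elim path_peel[of _ _ _ bl']) (auto simp: path_one)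
    have fins: "finite x" "finite y" "finite m" "finite m'"
      using fin unfolding p(4) m'(2) by auto
    have disj: "x \<inter> y = {}" "x \<inter> m = {}" "x \<inter> m' = {}" "y \<inter> m = {}" "y \<inter> m' = {}" "m \<inter> m' = {}"
      using packing unfolding p(4) m'(2) by (auto simp: packing_add)
    have cm': "card m' = r" using m'(1) by (rule edge_card)
    have u: "card (x \<union> w \<union> y) = k" if "finite w" "card w = r" "x \<inter> w = {}" "y \<inter> w = {}" for w
    proof -
      have "(x \<union> w) \<inter> y = {}" using disj that by auto
      then show ?thesis using that fins disj m' by (simp add: card_Un_disjoint)
    qed
    have "(x \<union> m' \<union> y) \<inter> (x \<union> m \<union> y) = x \<union> y" using disj by auto
    then have "card ((x \<union> m' \<union> y) \<inter> (x \<union> m \<union> y)) = 2 * l"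
      using fins disj m' by (simp add: card_Un_disjoint)
    moreover have "c (x \<union> m' \<union> y) = c (x \<union> m \<union> y)"
      using m'(1) p(3) 2 by (simp add: edge_def Un_ac)
    ultimately have "mono_cycle ((x \<union> m' \<union> y) \<union> (x \<union> m \<union> y))"
      using fins disj p(2) cm' u by (intro mono_cycle_two) auto
    moreover have "(x \<union> m' \<union> y) \<union> (x \<union> m \<union> y) = support bl" unfolding p(4) m'(2) by auto
    ultimately show ?thesis by simp
  next
    case 3
    then have ecl: "edge col y m x" using p(3) by auto
    obtain Lf Mf where f: "Lf 0 = x" "Lf (n - 1) = y"
      "\<And>i. Suc i < n \<Longrightarrow> edge col (Lf i) (Mf i) (Lf (Suc i))"
      "\<And>i. i < n \<Longrightarrow> card (Lf i) = l" "support bl' = (\<Union>i<n. Lf i) \<union> (\<Union>i<n - 1. Mf i)"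
      using path_functions[OF p(1)] by metis
    define M where "M i = (if Suc i = n then m else Mf i)" for i
    have ed: "edge col (Lf i) (M i) (Lf (Suc i mod n))" if "i < n" for i
    proof (cases "Suc i = n")
      case True
      then have "i = n - 1" by simp
      then show ?thesis using True ecl f(1,2) by (simp add: M_def)
    next
      case False
      then show ?thesis using that f(3)[of i] by (simp add: M_def)
    qed
    have nn: "{..<n} = insert (n - 1) {..<n - 1}" using 3 by auto
    have "(\<Union>i<n. M i) = m \<union> (\<Union>i<n - 1. Mf i)"
    proof -
      have "M (n - 1) = m" "\<And>i. i < n - 1 \<Longrightarrow> M i = Mf i" using 3 by (auto simp: M_def)
      then show ?thesis unfolding nn by simp
    qed
    then have U: "support bl = (\<Union>i<n. Lf i \<union> M i)" unfolding p(4) using f(5) by auto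
    have "\<exists>xs. set xs = X \<and> length xs = card X" if "X \<subseteq> support bl" for X
      using that fin finite_subset finite_distinct_list distinct_card by metis
    then obtain e where e: "\<And>X. X \<subseteq> support bl \<Longrightarrow> set (e X) = X \<and> length (e X) = card X"
      by metis
    let ?b = "\<lambda>i. e (Lf i) @ e (M i)"
    have b: "set (e (Lf i)) = Lf i" "set (e (M i)) = M i" "length (e (Lf i)) = l" "length (e (M i)) = r"
      if "i < n" for i
      using that e[of "Lf i"] e[of "M i"] U f(4) edge_card[OF ed] by auto
    show ?thesis
    proof (rule mono_cycle_long[OF 3 card, of ?b col])
      show "length (?b i) = s" if "i < n" for i using b[OF that] by simp
      show "support bl = (\<Union>i<n. set (?b i))" using b U by auto
      show "c (set (?b i) \<union> set (take l (?b (Suc i mod n)))) = col" if "i < n" for i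
      proof -
        have "Suc i mod n < n" using 3 by simp
        then show ?thesis using b[OF that] b[of "Suc i mod n"] ed[OF that] by (simp add: edge_def)
      qed
    qed
  qed
qed

section \<open>How many units may be missed\<close>

lemma covers_closed_pair:
  assumes "closed col n bl" "closed col' n' bl'" "packing (bl + bl')" "N \<le> n + n' + 2"
  shows "covers 3 V"
proof -
  let ?U = "V - (support bl \<union> support bl')"
  have packing: "packing bl" "packing bl'" using assms(3) by (auto elim: packing_mono)
  have disj: "support bl \<inter> support bl' = {}" using assms(3) by (rule packing_disjoint)
  have sub: "support bl \<union> support bl' \<subseteq> V" using packing_support[OF assms(3)] by simp
  have "card (support bl \<union> support bl') = (n + n') * s"
    using packing assms(1,2) disj by (simp add: card_Un_disjoint finite_support card_closed add_mult_distrib)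
  then have "card ?U = N * s - (n + n') * s"
    using card_Diff_subset[OF _ sub] packing finite_support card_V by simp
  then have "card ?U = (N - (n + n')) * s" by (simp add: diff_mult_distrib)
  then have rest: "covers 1 ?U" using assms(4) by (intro covers_le_two_units) auto
  have "covers (1 + 1) (support bl \<union> support bl')"
    using assms(1,2) packing disj by (intro covers_Un covers_mono_cycle mono_cycle_closed)
  then have "covers (1 + 1 + 1) (support bl \<union> support bl' \<union> ?U)"
    by (rule covers_Un[OF _ rest]) blast
  moreover have "support bl \<union> support bl' \<union> ?U = V" using sub by auto
  ultimately show ?thesis by (simp add: numeral_3_eq_3)
qed

text \<open>At most four units remain outside, and they split into two parts of at most two units,
  each one cycle.\<close>

lemma covers_closed_single:
  assumes "closed col n bl" "packing bl" "N \<le> n + 4"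
  shows "covers 3 V"
proof -
  let ?U = "V - support bl"
  have sub: "support bl \<subseteq> V" using packing_support[OF assms(2)] .
  have "card ?U = N * s - n * s"
    using card_Diff_subset[OF _ sub] finite_support[OF assms(2)] card_V card_closed[OF assms(1,2)] by simp
  then have "card ?U = (N - n) * s" by (simp add: diff_mult_distrib)
  then have "covers 2 ?U" using assms(3) by (intro covers_le_four_units) auto
  moreover have "covers 1 (support bl)"
    using assms(1,2) by (intro covers_mono_cycle mono_cycle_closed)
  ultimately have "covers (1 + 2) (support bl \<union> ?U)" by (intro covers_Un) auto
  moreover have "support bl \<union> ?U = V" using sub by auto
  ultimately show ?thesis by (simp add: numeral_3_eq_3)
qed

subsection \<open>A red cycle and a blue path\<close>

lemma obtain_block:
  assumes "packing bl" "card (support bl) + j \<le> N * s"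
  obtains M where "card M = j" "packing (add_mset M bl)"
proof -
  have "card (V - support bl) = N * s - card (support bl)"
    using card_Diff_subset[OF finite_support packing_support] assms(1) card_V by simp
  then have "j \<le> card (V - support bl)" using assms(2) by linarith
  then obtain M where "M \<subseteq> V - support bl" "card M = j" by (meson obtain_subset_with_card_n)
  then show thesis using that[of M] assms(1) by (auto simp: packing_add)
qed

lemma card_path: "path (edge col) n x bl y \<Longrightarrow> packing bl \<Longrightarrow> card (support bl) + r = n * s"
  using path_sum[of "edge col"] edge_card by (metis card_support)

lemma card_support_add: "packing (A + B) \<Longrightarrow> card (support (A + B)) = card (support A) + card (support B)"
  using card_support[of "A + B"] card_support[of A] card_support[of B] packing_mono[of "A + B" A] packing_mono[of "A + B" B] by simp

lemma card_support_add_mset: "packing (add_mset X B) \<Longrightarrow> card (support (add_mset X B)) = card X + card (support B)"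
  using card_support[of "add_mset X B"] card_support[of B] packing_mono[of "add_mset X B" B] by simp

text \<open>Admits the empty path. Only the end \<open>x\<close>, where the path is going to be
  extended, is recorded.\<close>

definition opt_path :: "colour \<Rightarrow> nat \<Rightarrow> 'a set multiset \<Rightarrow> 'a set \<Rightarrow> bool" where
  "opt_path col n bl x \<longleftrightarrow> (if n = 0 then bl = {#} else \<exists>y. path (edge col) n x bl y)"

text \<open>Gives up the end \<open>x\<close>. The released \<open>r\<close>-block is in
  \<open>D\<close>, which is empty if \<open>x\<close> was the only \<open>l\<close>-block.\<close>

lemma opt_path_peel:
  assumes "path (edge col) n x bl y"
  obtains x' bl' D where "opt_path col (n - 1) bl' x'" "bl = add_mset x (bl' + D)"
proof (cases "n = 1")
  case True
  then show thesis using assms that[of "{#}" x "{#}"] by (simp add: path_one opt_path_def)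
next
  case False
  from path_peel[OF assms False] obtain m z bl' n' where p: "n = Suc n'" "0 < n'"
    "path (edge col) n' z bl' y" "bl = add_mset x (add_mset m bl')" by metis
  then show thesis using that[of bl' z "{#m#}"] by (auto simp: opt_path_def)
qed

text \<open>Let a new block \<open>x\<close> extend neither path: it is joined in red to the blue
  end \<open>h\<close> and in blue to the red end \<open>g\<close>. The colour between
  \<open>h\<close> and \<open>g\<close> then lets one path take both \<open>x\<close> and the end of
  the other, a gain of two against a loss of one.\<close>

lemma two_paths:
  assumes "n \<le> N"
  shows "\<exists>a b A B h g. a + b = n \<and> opt_path Blue a A h \<and> opt_path Red b B g \<and> packing (A + B)"
  using assms
proof (induction n)
  case 0
  then show ?case by (auto simp: opt_path_def intro!: exI[of _ "{#}"])
next
  case (Suc n)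
  then obtain a b A B h g where ab: "a + b = n" "opt_path Blue a A h" "opt_path Red b B g" "packing (A + B)"
    by auto
  have okA: "packing A" and okB: "packing B" using ab(4) by (auto elim: packing_mono)
  have space: "n * s + s \<le> N * s"
    using Suc.prems mult_le_mono1[of "Suc n" N s] by simp
  have cA: "card (support A) + (if a = 0 then 0 else r) = a * s"
    using ab(2) card_path okA by (auto simp: opt_path_def split: if_splits)
  have cB: "card (support B) + (if b = 0 then 0 else r) = b * s"
    using ab(3) card_path okB by (auto simp: opt_path_def split: if_splits)
  have cAB: "card (support (A + B)) = card (support A) + card (support B)" using ab(4) by (rule card_support_add)
  have ns: "n * s = a * s + b * s" using ab(1) by (simp add: add_mult_distrib[symmetric])
  show ?case
  proof (cases "a = 0 \<or> b = 0")
    case True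
    have "card (support (A + B)) + l \<le> N * s" using space cA cB cAB ns by linarith
    then obtain x where x: "card x = l" "packing (add_mset x (A + B))" using obtain_block[OF ab(4)] by metis
    have "path (edge col) (Suc 0) x {#x#} x" for col by (rule path.single[OF x(1)])
    then have p: "opt_path col (Suc 0) {#x#} x" for col by (auto simp: opt_path_def)
    from True show ?thesis
    proof
      assume "a = 0"
      then show ?thesis using p[of Blue] ab x
        by (intro exI[of _ "Suc 0"] exI[of _ b] exI[of _ "{#x#}"] exI[of _ B]) (auto simp: opt_path_def)
    next
      assume "b = 0"
      then show ?thesis using p[of Red] ab x
        by (intro exI[of _ a] exI[of _ "Suc 0"] exI[of _ A] exI[of _ "{#x#}"]) (auto simp: opt_path_def)
    qed
  next
    case False
    then obtain y z where pA: "path (edge Blue) a h A y" and pB: "path (edge Red) b g B z"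
      using ab(2,3) by (auto simp: opt_path_def)
    \<comment> \<open>Each of the two paths lacks one \<open>r\<close>-block, so besides the new
      unit \<open>l + r\<close> another \<open>2 * r\<close> vertices are free: room for
      \<open>x\<close> and three middle blocks.\<close>
    have c0: "card (support (A + B)) + (l + 3 * r) \<le> N * s" using space cA cB cAB ns False by simp
    then have "card (support (A + B)) + l \<le> N * s" by linarith
    then obtain x where x: "card x = l" "packing (add_mset x (A + B))" using obtain_block[OF ab(4)] by metis
    have "card (support (add_mset x (A + B))) + r \<le> N * s"
      using c0 x by (simp only: card_support_add_mset)
    then obtain M1 where M1: "card M1 = r" "packing (add_mset M1 (add_mset x (A + B)))"
      using obtain_block[OF x(2)] by metis
    have "card (support (add_mset M1 (add_mset x (A + B)))) + r \<le> N * s"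
      using c0 x M1 by (simp only: card_support_add_mset)
    then obtain M2 where M2: "card M2 = r" "packing (add_mset M2 (add_mset M1 (add_mset x (A + B))))"
      using obtain_block[OF M1(2)] by metis
    have "card (support (add_mset M2 (add_mset M1 (add_mset x (A + B))))) + r \<le> N * s"
      using c0 x M1 M2 by (simp only: card_support_add_mset)
    then obtain M3 where M3: "card M3 = r"
      and packing: "packing (add_mset M3 (add_mset M2 (add_mset M1 (add_mset x (A + B)))))"
      using obtain_block[OF M2(2)] by metis
    show ?thesis
    proof (cases "edge Blue x M1 h")
      case True
      have "opt_path Blue (Suc a) (add_mset x (add_mset M1 A)) x"
        using path.step[OF x(1), of "edge Blue", OF True pA] by (auto simp: opt_path_def)
      moreover have "packing (add_mset x (add_mset M1 A) + B)" by (rule packing_mono[OF packing]) simp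
      ultimately show ?thesis using ab(1,3) by (metis add_Suc)
    next
      case nb: False
      show ?thesis
      proof (cases "edge Red x M2 g")
        case True
        have "opt_path Red (Suc b) (add_mset x (add_mset M2 B)) x"
          using path.step[OF x(1), of "edge Red", OF True pB] by (auto simp: opt_path_def)
        moreover have "packing (A + add_mset x (add_mset M2 B))" by (rule packing_mono[OF packing]) simp
        ultimately show ?thesis using ab(1,2) by (metis add_Suc_right)
      next
        case nr: False
        have red: "edge Red x M1 h" and blue: "edge Blue x M2 g"
          using nb nr M1 M2 edge_Red edge_Blue by auto
        show ?thesis
        proof (cases "edge Red h M3 g")
          case True
          obtain h' A' D where h': "opt_path Blue (a - 1) A' h'" "A = add_mset h (A' + D)"
            using opt_path_peel[OF pA] by metis
          have "path (edge Red) (Suc b) h (add_mset h (add_mset M3 B)) z"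
            using True pB path_start[OF pA] by (intro path.step) auto
          then have "path (edge Red) (Suc (Suc b)) x (add_mset x (add_mset M1 (add_mset h (add_mset M3 B)))) z"
            using red x by (intro path.step) auto
          then have "opt_path Red (Suc (Suc b)) (add_mset x (add_mset M1 (add_mset h (add_mset M3 B)))) x"
            by (auto simp: opt_path_def)
          moreover have "packing (A' + add_mset x (add_mset M1 (add_mset h (add_mset M3 B))))"
            by (rule packing_mono[OF packing]) (simp add: h'(2))
          moreover have "a - 1 + Suc (Suc b) = Suc n" using ab(1) False by simp
          ultimately show ?thesis using h'(1) by blast
        next
          case 2: False
          then have blue2: "edge Blue g M3 h" using edge_Blue M3 edge_sym by blast
          obtain g' B' D where g': "opt_path Red (b - 1) B' g'" "B = add_mset g (B' + D)"
            using opt_path_peel[OF pB] by metis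
          have "path (edge Blue) (Suc a) g (add_mset g (add_mset M3 A)) y"
            using blue2 pA path_start[OF pB] by (intro path.step) auto
          then have "path (edge Blue) (Suc (Suc a)) x (add_mset x (add_mset M2 (add_mset g (add_mset M3 A)))) y"
            using blue x by (intro path.step) auto
          then have "opt_path Blue (Suc (Suc a)) (add_mset x (add_mset M2 (add_mset g (add_mset M3 A)))) x"
            by (auto simp: opt_path_def)
          moreover have "packing (add_mset x (add_mset M2 (add_mset g (add_mset M3 A))) + B')"
            by (rule packing_mono[OF packing]) (simp add: g'(2))
          moreover have "Suc (Suc a) + (b - 1) = Suc n" using ab(1) False by simp
          ultimately show ?thesis using g'(1) by blast
        qed
      qed
    qed
  qed
qed

text \<open>The blue path eats the red path alternately from both ends. The block \<open>t\<close> is spare: it tests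
  whether the rest of the red path closes up, and each step frees a new spare block.\<close>

lemma zigzag:
  assumes red: "\<And>x m y. R x m y \<Longrightarrow> edge Red x m y" and sym: "\<And>x m y. R x m y \<Longrightarrow> R y m x"
    and P: "\<And>x m y. R x m y \<Longrightarrow> P x"
    and "path (edge Blue) a y A w" "P w" "edge Blue w m u" "path R p u I e" "P u" "card t = r"
  obtains (closed) a' A' w' p' J where "path (edge Blue) a' y A' w'" "P w'" "closed Red p' J" "2 \<le> p'"
      "a' + p' = a + p" "A' + J \<subseteq># add_mset t (add_mset m (A + I))"
    | (path) A' w' where "path (edge Blue) (a + p) y A' w'" "P w'" "A' \<subseteq># add_mset t (add_mset m (A + I))"
  using assms(4-9)
proof (induction p arbitrary: a A w m u I e t thesis)
  case 0
  then show ?case using path_pos by blast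
next
  case (Suc p)
  note closed = Suc.prems(1) and path = Suc.prems(2) and prems = Suc.prems(3-)
  have cu: "card u = l" using path_start[OF prems(4)] by simp
  have step: "path (edge Blue) (Suc a) y (add_mset u (add_mset m A)) u"
    using prems(1,3) cu by (rule path_snoc)
  show ?case
  proof (cases "p = 0")
    case True
    then have "I = {#u#}" using prems(4) by (simp add: path_one)
    then show ?thesis using True step prems(5) by (intro path[of "add_mset u (add_mset m A)" u]) simp_all
  next
    case False
    show ?thesis
    proof (cases "edge Red e t u")
      case True
      have "path (edge Red) (Suc p) u I e" using red prems(4) by (rule path_mono)
      then have "closed Red (Suc p) (add_mset t I)" using True by (rule closedI)
      then show ?thesis using prems(1,2) False by (intro closed[of a A w "Suc p" "add_mset t I"]) simp_all
    next
      case nr: False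
      then have blue: "edge Blue u t e" using edge_Blue prems(6) edge_sym by blast
      obtain m' v I' p' where v: "Suc p = Suc p'" "R u m' v" "path R p' v I' e" "I = add_mset u (add_mset m' I')"
        using path_peel[OF prems(4)] False by (metis One_nat_def nat.inject)
      \<comment> \<open>Reversal makes the next round eat from the other end; the freed
        \<open>m'\<close> becomes the spare block.\<close>
      have rev: "path R p e I' v" using path_rev[of R, OF sym] v by auto
      \<comment> \<open>\<open>P\<close> is an invariant of the blue end. It holds for every block
        on an \<open>R\<close>-edge, and \<open>e\<close> lies on one: on \<open>u m' v\<close> if
        it is the last block left, otherwise on the remaining path.\<close>
      have "P e"
      proof (cases "p = 1")
        case True
        then have "path R (Suc 0) v I' e" using v(1,3) by simp
        then have "e = v" by (simp only: path_one)
        then show ?thesis using P sym v(2) by blast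
      next
        case False
        then show ?thesis using path_peel[OF rev] P by metis
      qed
      have eq: "add_mset m' (add_mset t (add_mset u (add_mset m A) + I')) = add_mset t (add_mset m (A + I))"
        by (simp add: v(4) add_mset_commute)
      show ?thesis
      proof (rule Suc.IH[OF _ _ step prems(5) blue rev \<open>P e\<close> edge_card[OF red[OF v(2)]]], goal_cases)
        case (1 a' A' w' p' J)
        then show ?case unfolding eq by (intro closed[of a' A' w' p' J]) simp_all
      next
        case (2 A' w')
        then show ?case unfolding eq by (intro path[of A' w']) simp_all
      qed
    qed
  qed
qed

section \<open>Configurations\<close>

definition config where
  "config A K B y Q z \<longleftrightarrow> 2 \<le> A \<and> closed Red A K \<and> path (edge Blue) B y Q z \<and> A + B + 1 = N \<and> packing (K + Q)"

text \<open>Beyond the blue path there is room for two \<open>r\<close>-blocks. Neither closes it in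
  blue, since that cycle would miss only one unit; so both join its ends in red, and the ends form a
  red cycle of length two that is cut off the path.\<close>

lemma config_of_blue_path:
  assumes nc: "\<not> covers 3 V" and N: "5 \<le> N" and p: "path (edge Blue) (N - 1) y A z" and packing: "packing A"
  shows "\<exists>A K B y Q z. config A K B y Q z"
proof -
  have "(N - 1) * s + s = N * s" using N by (cases N) auto
  then have "card (support A) + r + s = N * s" using card_path[OF p packing] by simp
  then have "card (support A) + r \<le> N * s" "card (support A) + r + r \<le> N * s" by linarith+
  then obtain M where M: "card M = r" "packing (add_mset M A)" using obtain_block[OF packing] by metis
  have "card (support (add_mset M A)) + r \<le> N * s"
    using \<open>card (support A) + r + r \<le> N * s\<close> M by (simp only: card_support_add_mset)
  then obtain T where T: "card T = r" and okT: "packing (add_mset T (add_mset M A))"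
    using obtain_block[OF M(2)] by metis
  have red: "edge Red z W y" if "card W = r" "packing (add_mset W A)" for W
  proof (rule ccontr)
    assume "\<not> edge Red z W y"
    then have "edge Blue z W y" using that edge_Blue by auto
    then have "closed Blue (N - 1) (add_mset W A)" using closedI p by blast
    then show False using covers_closed_single that nc by force
  qed
  have "packing (add_mset T A)" by (rule packing_mono[OF okT]) simp
  then have redM: "edge Red z M y" and redT: "edge Red z T y" using red M T by auto
  have "N - 1 \<noteq> 1" using N by simp
  then obtain m u A1 n1 where 1: "N - 1 = Suc n1" "path (edge Blue) n1 u A1 z" "A = add_mset y (add_mset m A1)" "card y = l"
    using path_peel[OF p] by metis
  have "n1 \<noteq> 1" using N 1 by simp
  then obtain m' u' A2 n2 where 2: "n1 = Suc n2" "path (edge Blue) n2 u' A2 u" "A1 = add_mset z (add_mset m' A2)" "card z = l"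
    using path_peel[OF edge_path_rev[OF 1(2)]] by metis
  have "path (edge Red) 2 z (add_mset z (add_mset M {#y#})) y"
    using path.step[of z "edge Red", OF 2(4) redM path.single[OF 1(4)]] by (simp add: numeral_2_eq_2)
  then have "closed Red 2 (add_mset T (add_mset z (add_mset M {#y#})))"
    using edge_sym[OF redT] by (rule closedI)
  moreover have "packing (add_mset T (add_mset z (add_mset M {#y#})) + A2)"
    by (rule packing_mono[OF okT]) (simp add: 1(3) 2(3))
  ultimately have "config 2 (add_mset T (add_mset z (add_mset M {#y#}))) n2 u' A2 u"
    using 1 2 N by (simp add: config_def)
  then show ?thesis by blast
qed

lemma config_of_zigzag:
  assumes nc: "\<not> covers 3 V" and N: "5 \<le> N"
    and p: "path (edge Blue) a y A w" "edge Blue w m u" "path (edge Red) p u I e" "card t = r"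
    and ap: "a + p = N - 1" and packing: "packing (add_mset t (add_mset m (A + I)))"
  shows "\<exists>A K B y Q z. config A K B y Q z"
proof (rule zigzag[where R = "edge Red" and P = "\<lambda>_. True", OF _ edge_sym _ p(1) TrueI p(2,3) TrueI p(4)])
  fix a' A' w' p' J
  assume *: "path (edge Blue) a' y A' w'" "closed Red p' J" "2 \<le> p'" "a' + p' = a + p"
    "A' + J \<subseteq># add_mset t (add_mset m (A + I))"
  have "packing (J + A')" using packing_mono[OF packing *(5)] by (simp add: union_commute)
  moreover have "p' + a' + 1 = N" using *(4) ap N by linarith
  ultimately have "config p' J a' y A' w'" unfolding config_def using * by blast
  then show ?thesis by blast
next
  fix A' w' assume "path (edge Blue) (a + p) y A' w'" "A' \<subseteq># add_mset t (add_mset m (A + I))"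
  then show ?thesis using config_of_blue_path[OF nc N] packing_mono[OF packing] ap by metis
qed simp_all

text \<open>The red path does not close up in red, so its ends are joined in blue. Its first block
  becomes a one-block blue path that eats the rest from the far end; the \<open>r\<close>-block
  behind it is the first spare.\<close>

lemma config_of_red_path:
  assumes nc: "\<not> covers 3 V" and N: "5 \<le> N" and p: "path (edge Red) (N - 1) y A z" and packing: "packing A"
  shows "\<exists>A K B y Q z. config A K B y Q z"
proof -
  have "(N - 1) * s + s = N * s" using N by (cases N) auto
  then have "card (support A) + r \<le> N * s" using card_path[OF p packing] by simp
  then obtain M where M: "card M = r" "packing (add_mset M A)" using obtain_block[OF packing] by metis
  have "\<not> edge Red z M y"
  proof
    assume "edge Red z M y"
    then have "closed Red (N - 1) (add_mset M A)" using closedI p by blast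
    then show False using covers_closed_single M nc by force
  qed
  then have blue: "edge Blue y M z" using M edge_Blue edge_sym by blast
  have "N - 1 \<noteq> 1" using N by simp
  then obtain m u A1 n1 where 1: "N - 1 = Suc n1" "edge Red y m u" "path (edge Red) n1 u A1 z"
    "A = add_mset y (add_mset m A1)" "card y = l"
    using path_peel[OF p] by metis
  have "packing (add_mset m (add_mset M ({#y#} + A1)))" by (rule packing_mono[OF M(2)]) (simp add: 1(4))
  then show ?thesis
    using config_of_zigzag[OF nc N path.single[OF 1(5)] blue edge_path_rev[OF 1(3)] edge_card[OF 1(2)]] 1(1)
    by simp
qed

text \<open>Two paths with \<open>N - 1\<close> blocks in total are joined by a block
  \<open>M\<close>. If the join is blue, the blue path starts eating; if it is red, the blue end
  \<open>h\<close> is first handed to the red path, to which the shortened blue path is still joined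
  in blue.\<close>

lemma config_exists:
  assumes nc: "\<not> covers 3 V" and N: "5 \<le> N"
  shows "\<exists>A K B y Q z. config A K B y Q z"
proof -
  obtain a b A B h g where ab: "a + b = N - 1" "opt_path Blue a A h" "opt_path Red b B g" and packing: "packing (A + B)"
    using two_paths[of "N - 1"] by auto
  consider "a = 0" | "b = 0" | "a \<noteq> 0" "b \<noteq> 0" by blast
  then show ?thesis
  proof cases
    case 1
    then show ?thesis using ab packing N config_of_red_path[OF nc N] by (auto simp: opt_path_def split: if_splits)
  next
    case 2
    then show ?thesis using ab packing N config_of_blue_path[OF nc N] by (auto simp: opt_path_def split: if_splits)
  next
    case 3
    then obtain y z where pA: "path (edge Blue) a h A y" and pB: "path (edge Red) b g B z"
      using ab(2,3) by (auto simp: opt_path_def)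
    have okA: "packing A" and okB: "packing B" using packing by (auto elim: packing_mono)
    have "(a + b) * s + s = N * s" unfolding ab(1) using N by (cases N) auto
    then have c: "card (support (A + B)) + r + r + s = N * s"
      using card_path[OF pA okA] card_path[OF pB okB] card_support_add[OF packing] by (simp add: add_mult_distrib)
    then have "card (support (A + B)) + r \<le> N * s" by linarith
    then obtain M where M: "card M = r" "packing (add_mset M (A + B))" using obtain_block[OF packing] by metis
    have "card (support (add_mset M (A + B))) + r \<le> N * s"
      using c M by (simp only: card_support_add_mset)
    then obtain T where T: "card T = r" and okT: "packing (add_mset T (add_mset M (A + B)))"
      using obtain_block[OF M(2)] by metis
    show ?thesis
    proof (cases "edge Blue h M g")
      case True
      then show ?thesis using config_of_zigzag[OF nc N edge_path_rev[OF pA] True pB T(1) ab(1) okT] by simp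
    next
      case False
      then have "edge Red h M g" using M edge_Red by auto
      then have red: "path (edge Red) (Suc b) h (add_mset h (add_mset M B)) z"
        using path.step[of h "edge Red"] path_start[OF pA] pB by blast
      show ?thesis
      proof (cases "a = 1")
        case True
        then have "A = {#h#}" using pA by (simp add: path_one)
        then have "packing (add_mset h (add_mset M B))" using M(2) by (simp add: add_mset_commute)
        then show ?thesis using config_of_red_path[OF nc N] red True ab(1) by auto
      next
        case a1: False
        obtain m h' A1 a' where 1: "a = Suc a'" "edge Blue h m h'" "path (edge Blue) a' h' A1 y"
          "A = add_mset h (add_mset m A1)"
          using path_peel[OF pA a1] by metis
        have "packing (add_mset T (add_mset m (A1 + add_mset h (add_mset M B))))"
          by (rule packing_mono[OF okT]) (simp add: 1(4))
        then show ?thesis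
          using config_of_zigzag[OF nc N edge_path_rev[OF 1(3)] edge_sym[OF 1(2)] red T(1)] 1(1) ab(1) by simp
      qed
    qed
  qed
qed

end

subsection \<open>Maximal red cycles\<close>

text \<open>The blue path is \<open>y1 m1 y2 m2 q \<dots> q' m' yB\<close>, with \<open>b\<close> many \<open>l\<close>-blocks from \<open>q\<close> to \<open>q'\<close>.\<close>

locale extremal = cover_setup +
  fixes A b :: nat and K Q :: "'a set multiset" and y1 m1 y2 m2 q q' m' yB :: "'a set"
  assumes not_covers: "\<not> covers 3 V"
    and closed_K: "closed Red A K" and A2: "2 \<le> A"
    and path_Q: "path (edge Blue) b q Q q'"
    and e1: "edge Blue y1 m1 y2" and e2: "edge Blue y2 m2 q" and e': "edge Blue q' m' yB"
    and cards: "card y1 = l" "card y2 = l" "card yB = l"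
    and ok_all: "packing (K + Q + {#y1, m1, y2, m2, m', yB#})"
    and count: "A + b + 4 = N"
    and maximal: "\<And>A' K' B' y Y z. config A' K' B' y Y z \<Longrightarrow> A' \<le> A"
begin

lemma no_pair:
  "closed col n bl \<Longrightarrow> closed col' n' bl' \<Longrightarrow> N \<le> n + n' + 2 \<Longrightarrow> packing (bl + bl') \<Longrightarrow> False"
  using covers_closed_pair not_covers by blast

lemma no_better:
  assumes "closed Red A' K'" "path (edge Blue) B' y Y z" "A' + B' + 1 = N" "A < A'" "packing (K' + Y)"
  shows False
proof -
  have "config A' K' B' y Y z" using assms A2 unfolding config_def by simp
  then show False using maximal assms(4) by fastforce
qed

abbreviation blue_blocks :: "'a set multiset" where
  "blue_blocks \<equiv> Q + {#y1, m1, y2, m2, m', yB#}"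

lemma blue_y2_q': "path (edge Blue) (Suc b) y2 (add_mset y2 (add_mset m2 Q)) q'"
  using cards(2) e2 path_Q by (rule path.step)

lemma blue_y2_yB: "path (edge Blue) (Suc (Suc b)) y2 (add_mset yB (add_mset m' (add_mset y2 (add_mset m2 Q)))) yB"
  using blue_y2_q' e' cards(3) by (rule path_snoc)

lemma blue_y1_yB: "path (edge Blue) (Suc (Suc (Suc b))) y1
    (add_mset y1 (add_mset m1 (add_mset yB (add_mset m' (add_mset y2 (add_mset m2 Q)))))) yB"
  using cards(1) e1 blue_y2_yB by (rule path.step)

text \<open>A blue closing edge would give two cycles missing only one unit.\<close>

lemma red_y1_yB:
  assumes "card M = r" "packing (add_mset M (K + blue_blocks))" shows "edge Red y1 M yB"
proof (rule ccontr)
  assume "\<not> edge Red y1 M yB"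
  then have "edge Blue yB M y1" using assms(1) edge_Blue edge_sym by blast
  with blue_y1_yB have "closed Blue (Suc (Suc (Suc b)))
      (add_mset M (add_mset y1 (add_mset m1 (add_mset yB (add_mset m' (add_mset y2 (add_mset m2 Q)))))))"
    by (rule closedI)
  from no_pair[OF closed_K this] show False
    using count packing_mono[OF assms(2)] by simp
qed

text \<open>Dropping \<open>y1\<close> frees \<open>m1\<close>; closing the rest of the blue path
  with it would give two cycles missing two units.\<close>

lemma red_yB_m1_y2: "edge Red yB m1 y2"
proof (rule ccontr)
  assume "\<not> edge Red yB m1 y2"
  then have "edge Blue yB m1 y2" using e1 edge_card edge_Blue by blast
  with blue_y2_yB have "closed Blue (Suc (Suc b))
      (add_mset m1 (add_mset yB (add_mset m' (add_mset y2 (add_mset m2 Q)))))"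
    by (rule closedI)
  from no_pair[OF closed_K this] show False
    using count packing_mono[OF ok_all] by simp
qed

text \<open>\<open>cedge x m y\<close>: the blocks \<open>x\<close>, \<open>m\<close>, \<open>y\<close> are consecutive on the red cycle.\<close>

definition cedge :: "'a set \<Rightarrow> 'a set \<Rightarrow> 'a set \<Rightarrow> bool" where
  "cedge x m y \<longleftrightarrow> edge Red x m y \<and> (\<exists>bl. path (edge Red) A y bl x \<and> K = add_mset m bl)"

lemma cedge_red: "cedge x m y \<Longrightarrow> edge Red x m y"
  by (simp add: cedge_def)

lemma cedge_sym: "cedge x m y \<Longrightarrow> cedge y m x"
  unfolding cedge_def using edge_sym edge_path_rev by blast

lemma cedge_path_rev: "path cedge n x bl y \<Longrightarrow> path cedge n y bl x"
  by (rule path_rev[OF cedge_sym])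

text \<open>Induction along an arc of the cycle: its first block moves to the complementary arc, so
  that the path around the cycle required by \<open>cedge\<close> is exhibited for each edge in
  turn.\<close>

lemma path_cedge:
  assumes "path (edge Red) n x bl y" "path (edge Red) n0 u bl0 v" "edge Red v m x" "edge Red y m0 u"
    "n0 + n = A" "K = bl0 + bl + {#m, m0#}"
  shows "path cedge n x bl y"
  using assms
proof (induction arbitrary: n0 bl0 v m rule: path.induct)
  case (single x)
  then show ?case by (intro path.single)
next
  case (step x m1 y n bl z)
  have "path (edge Red) (n + n0) y (bl + bl0 + {#m0#}) v"
    using path_append[OF step.hyps(3) step.prems(3,1)] .
  from path_snoc[OF this step.prems(2) step.hyps(1)]
  have "path (edge Red) A y (add_mset x (add_mset m (bl + bl0 + {#m0#}))) x"
    using step.prems(4) by (simp add: add.commute)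
  moreover have "K = add_mset m1 (add_mset x (add_mset m (bl + bl0 + {#m0#})))"
    using step.prems(5) by (simp add: union_commute add_mset_commute)
  ultimately have ce: "cedge x m1 y" unfolding cedge_def using step.hyps(2) by blast
  have "path cedge n y bl z"
  proof (rule step.IH)
    show "path (edge Red) (Suc n0) u (add_mset x (add_mset m bl0)) x"
      using step.prems(1,2) step.hyps(1) by (rule path_snoc)
    show "edge Red x m1 y" "edge Red z m0 u" by fact+
    show "Suc n0 + n = A" using step.prems(4) by simp
    show "K = add_mset x (add_mset m bl0) + bl + {#m1, m0#}"
      using step.prems(5) by (simp add: union_commute add_mset_commute)
  qed
  then show ?case using ce step.hyps(1) by (intro path.step)
qed

text \<open>Otherwise the red detour \<open>w M y1 M' yB m1 y2 S w'\<close> replaces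
  \<open>w S w'\<close>. The red cycle gains three blocks and the blue path keeps \<open>Q\<close>,
  against maximality.\<close>

lemma insertion:
  assumes "cedge w S w'" "edge Red y1 M w" "card M = r" "card M' = r"
    and packing: "packing (add_mset M (add_mset M' (K + blue_blocks)))"
  shows "edge Blue y2 S w'"
proof (rule ccontr)
  assume neg: "\<not> edge Blue y2 S w'"
  obtain bl where bl: "path (edge Red) A w' bl w" "K = add_mset S bl" and "edge Red w S w'"
    using assms(1) unfolding cedge_def by blast
  then have "edge Red y2 S w'" using neg edge_Red edge_card by blast
  from path.step[of y2 "edge Red", OF cards(2) this bl(1)]
  have "path (edge Red) (Suc A) y2 (add_mset y2 (add_mset S bl)) w" .
  from path.step[of yB "edge Red", OF cards(3) red_yB_m1_y2 this]
  have *: "path (edge Red) (Suc (Suc A)) yB (add_mset yB (add_mset m1 (add_mset y2 (add_mset S bl)))) w" .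
  have "edge Red y1 M' yB" by (rule red_y1_yB[OF assms(4)]) (rule packing_mono[OF packing], simp)
  from path.step[of y1 "edge Red", OF cards(1) this *]
  have "path (edge Red) (Suc (Suc (Suc A))) y1
     (add_mset y1 (add_mset M' (add_mset yB (add_mset m1 (add_mset y2 (add_mset S bl)))))) w" .
  from closedI[OF this edge_sym[OF assms(2)]] path_Q
  show False by (rule no_better) (use count in simp, simp, rule packing_mono[OF packing], simp add: bl(2))
qed

text \<open>The state of the zigzag after at least three steps. The blue path, from \<open>y2\<close> on, ends in
  \<open>a Ma d Mb w Mc u\<close>, and the uneaten part of the red cycle runs from \<open>u\<close> to \<open>e\<close>. On the red cycle, \<open>w\<close>
  follows \<open>e\<close> and \<open>a\<close> follows \<open>w\<close>, while \<open>d\<close> precedes \<open>u\<close>; the block \<open>S\<close> is spare. The block \<open>x1\<close>, where the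
  zigzag started, is left out but can be inserted between \<open>y1\<close> and \<open>y2\<close>.\<close>

lemma zigzag_end:
  assumes blue_Y: "path (edge Blue) n y2 Y a" and ea: "edge Blue a Ma d" and ed: "edge Blue d Mb w"
    and ew: "edge Blue w Mc u" and inner: "path cedge p u I e"
    and ce1: "cedge w S e" and ce2: "cedge d Mc u" and ce3: "cedge w Mb a"
    and x1: "edge Blue y1 m1 x1" "edge Blue x1 M0 y2" "card x1 = l"
    and M2: "card M2 = r" "card M' = r" "packing (add_mset M2 (add_mset M' (K + blue_blocks)))"
    and num: "N = n + p + 5"
    and packing: "packing (Y + I + {#Ma, d, Mb, w, Mc, S, y1, m1, x1, M0, M2#})"
  shows False
  using blue_Y ea ed ew inner ce1 ce2 ce3 num packing
proof (induction p arbitrary: n Y a Ma d Mb w Mc u I e S)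
  case 0
  then show ?case using path_pos by blast
next
  case (Suc p)
  note prems = Suc.prems
  have cM0: "card M0 = r" using x1(2) by (rule edge_card)
  have cu: "card u = l" using path_start[OF prems(5)] by simp
  have cd: "card d = l" "card w = l"
  proof -
    show "card d = l" using prems(7) path_end unfolding cedge_def by blast
    show "card w = l" using prems(8) path_end unfolding cedge_def by blast
  qed
  have inner_red: "path (edge Red) (Suc p) u I e" using cedge_red prems(5) by (rule path_mono)
  have Sr: "edge Red w S e" and Mcr: "edge Red d Mc u" using prems cedge_red by blast+
  have cS: "card S = r" using Sr by (rule edge_card)
  have blue_d: "path (edge Blue) (Suc n) y2 (add_mset d (add_mset Ma Y)) d"
    using prems(1,2) cd(1) by (rule path_snoc)
  have blue_w: "path (edge Blue) (Suc (Suc n)) y2 (add_mset w (add_mset Mb (add_mset d (add_mset Ma Y)))) w"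
    using blue_d prems(3) cd(2) by (rule path_snoc)
  show ?case
  proof (cases "p = 0 \<or> edge Red e S u")
    case True
    then have cl: "closed Red (Suc p) (add_mset S I)"
      unfolding closed_def using inner_red cS by (metis One_nat_def)
    \<comment> \<open>Otherwise \<open>y1 m1 y2 ... w\<close> closes up in blue and, with the red
      cycle \<open>cl\<close>, misses two units, one of them for \<open>x1\<close>.\<close>
    have red_w: "edge Red y1 M w" if "M \<in> {M0, M2}" for M
    proof (rule ccontr)
      assume "\<not> edge Red y1 M w"
      then have "edge Blue w M y1" using that cM0 M2(1) edge_Blue edge_sym by blast
      with path.step[of y1 "edge Blue", OF cards(1) e1 blue_w]
      have "closed Blue (Suc (Suc (Suc n)))
          (add_mset M (add_mset y1 (add_mset m1 (add_mset w (add_mset Mb (add_mset d (add_mset Ma Y)))))))"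
        by (rule closedI)
      from cl this show False
        by (rule no_pair) (use prems(9) that in \<open>auto intro!: packing_mono[OF prems(10)]\<close>)
    qed
    have "edge Blue y2 Mb a" using insertion[OF prems(8) red_w[of M2] M2] by simp
    then have clB: "closed Blue n (add_mset Mb Y)" using prems(1) closedI edge_sym by blast
    \<comment> \<open>Otherwise \<open>y1 m1 x1 M0 y2 ... d\<close> closes up in blue: now
      \<open>x1\<close> is inserted and \<open>w\<close> is left out.\<close>
    have "edge Red y1 M2 d"
    proof (rule ccontr)
      assume "\<not> edge Red y1 M2 d"
      then have "edge Blue d M2 y1" using M2(1) edge_Blue edge_sym by blast
      with path.step[of y1 "edge Blue", OF cards(1) x1(1) path.step[of x1 "edge Blue", OF x1(3,2) blue_d]]
      have "closed Blue (Suc (Suc (Suc n)))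
          (add_mset M2 (add_mset y1 (add_mset m1 (add_mset x1 (add_mset M0 (add_mset d (add_mset Ma Y)))))))"
        by (rule closedI)
      from cl this show False
        by (rule no_pair) (use prems(9) in \<open>auto intro!: packing_mono[OF prems(10)]\<close>)
    qed
    \<comment> \<open>The detour \<open>e S w M0 y1 M2 d Mc u\<close> closes the red path, while
      \<open>clB\<close> closes the blue path without \<open>d\<close>, \<open>w\<close> and
      \<open>y1\<close>. Again two units are missed.\<close>
    from path_snoc[OF path_snoc[OF path_snoc[OF inner_red edge_sym[OF Sr] cd(2)]
        edge_sym[OF red_w[of M0]] cards(1)] this cd(1)]
    have "path (edge Red) (Suc (Suc (Suc (Suc p)))) u
        (add_mset d (add_mset M2 (add_mset y1 (add_mset M0 (add_mset w (add_mset S I)))))) d" by simp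
    from closedI[OF this Mcr] clB show False
      by (rule no_pair) (use prems(9) in \<open>auto intro!: packing_mono[OF prems(10)]\<close>)
  next
    case False
    then have blue: "edge Blue u S e" using cS edge_Blue edge_sym by blast
    have "Suc p \<noteq> 1" using False by simp
    then obtain S' v I' where v: "cedge u S' v" "path cedge p v I' e" "I = add_mset u (add_mset S' I')"
      using path_peel[OF prems(5)] by (metis nat.inject)
    have rev: "path cedge p e I' v" using v(2) by (rule cedge_path_rev)
    show ?thesis
    \<comment> \<open>The state moves on by one block: \<open>d\<close>, \<open>w\<close>,
      \<open>u\<close>, \<open>e\<close> take the places of \<open>a\<close>, \<open>d\<close>,
      \<open>w\<close>, \<open>u\<close>, and the remaining red path is reversed.\<close>
    proof (rule Suc.IH[OF blue_d prems(3,4) blue rev v(1) prems(6) cedge_sym[OF prems(7)]])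
      show "N = Suc n + p + 5" using prems(9) by simp
      show "packing (add_mset d (add_mset Ma Y) + I' + {#Mb, w, Mc, u, S, S', y1, m1, x1, M0, M2#})"
        by (rule packing_mono[OF prems(10)]) (simp add: v(3))
    qed
  qed
qed

text \<open>The cycle fills \<open>A\<close> units and the blue path \<open>b + 3\<close> units up
  to one \<open>r\<close>-block. So \<open>s + r\<close> vertices are free, enough for two
  \<open>r\<close>-blocks.\<close>

lemma card_used: "card (support (K + blue_blocks)) + r + s = N * s"
proof -
  have okKB: "packing (K + blue_blocks)" by (rule packing_mono[OF ok_all]) simp
  then have okK: "packing K" and okB: "packing blue_blocks" by (auto elim: packing_mono)
  have eq: "blue_blocks = add_mset y1 (add_mset m1 (add_mset yB (add_mset m' (add_mset y2 (add_mset m2 Q)))))"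
    by (simp add: add_mset_commute)
  have "card (support blue_blocks) + r = Suc (Suc (Suc b)) * s"
    using card_path[OF blue_y1_yB] okB by (simp only: eq)
  then have "card (support (K + blue_blocks)) + r = A * s + Suc (Suc (Suc b)) * s"
    using card_support_add[OF okKB] card_closed[OF closed_K okK] by linarith
  moreover have "N * s = A * s + Suc (Suc (Suc b)) * s + s"
    by (simp add: count[symmetric] algebra_simps)
  ultimately show ?thesis by linarith
qed

lemma obtain_free:
  obtains M where "card M = r" "packing (add_mset M (K + blue_blocks))"
proof -
  have "packing (K + blue_blocks)" by (rule packing_mono[OF ok_all]) simp
  moreover have "card (support (K + blue_blocks)) + r \<le> N * s" using card_used by linarith
  ultimately show thesis using obtain_block that by metis
qed

lemma obtain_free2:
  assumes "card M = r" "packing (add_mset M (K + blue_blocks))"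
  obtains M' where "card M' = r" "packing (add_mset M' (add_mset M (K + blue_blocks)))"
proof -
  have "card (support (add_mset M (K + blue_blocks))) + r \<le> N * s"
    using card_support_add_mset[OF assms(2)] assms(1) card_used by linarith
  then show thesis using obtain_block[OF assms(2)] that by metis
qed

text \<open>The red cycle runs \<open>x0 M0 x1 M1 x2 S x3 \<dots> v S2\<close> and back to \<open>x0\<close>. The zigzag starts by skipping \<open>x1\<close>:
  the blue path continues from \<open>yB\<close> with \<open>x2\<close>, \<open>x0\<close>, \<open>x3\<close>, \<open>v\<close>.\<close>

lemma no_red_link:
  assumes ce0: "cedge x0 M0 x1" and Mo: "card Mo = r" "packing (add_mset Mo (K + blue_blocks))"
    and link: "edge Red y1 Mo x0"
  shows False
proof -
  obtain M2 where M2: "card M2 = r" and okM: "packing (add_mset M2 (add_mset Mo (K + blue_blocks)))"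
    using obtain_free2[OF Mo] by metis
  obtain bl0 where p0: "path (edge Red) A x1 bl0 x0" and K0: "K = add_mset M0 bl0" and r0: "edge Red x0 M0 x1"
    using ce0 unfolding cedge_def by blast
  have cx0: "card x0 = l" using path_end[OF p0] by simp
  have "A \<noteq> 1" using A2 by simp
  then obtain M1 x2 bl n where A: "A = Suc n" "0 < n" and r1: "edge Red x1 M1 x2"
    and p1: "path (edge Red) n x2 bl x0" and bl0: "bl0 = add_mset x1 (add_mset M1 bl)" and cx1: "card x1 = l"
    using path_peel[OF p0] by metis
  have K: "K = bl + {#M0, x1, M1#}" by (simp add: K0 bl0 add_mset_commute)
  define T where "T = bl + {#M0, x1, M1#} + Q + {#y1, m1, y2, m2, m', yB, Mo, M2#}"
  have okT: "packing T" using okM unfolding T_def K by (simp add: add_mset_commute)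
  have cM: "card M0 = r" "card M1 = r" "card m1 = r" "card m2 = r" "card m' = r"
    using r0 r1 e1 e2 e' edge_card by auto
  have yMo: "edge Red x0 Mo y1" using link by (rule edge_sym)
  have yM2: "edge Red y1 M2 yB"
    by (rule red_y1_yB[OF M2]) (rule packing_mono[OF okM], simp)
  have p1c: "path cedge n x2 bl x0"
    by (rule path_cedge[OF p1 path.single[OF cx1] r1 r0]) (simp_all add: A K add_mset_commute)
  \<comment> \<open>Otherwise \<open>y1\<close> can be inserted between \<open>x0\<close> and
    \<open>x1\<close>.\<close>
  have a: "edge Blue y1 M x1" if "M \<in> {M2, m1}" for M
  proof (rule ccontr)
    assume "\<not> edge Blue y1 M x1"
    then have "edge Red y1 M x1" using that M2 cM edge_Red by auto
    from closedI[OF path.step[of y1 "edge Red", OF cards(1) this p0] yMo] blue_y2_yB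
    show False by (rule no_better)
      (use count that in \<open>auto simp: bl0 T_def intro!: packing_mono[OF okT]\<close>)
  qed
  \<comment> \<open>Otherwise \<open>y1 M2 yB\<close> can be inserted between \<open>x0\<close> and
    \<open>x1\<close>.\<close>
  have b: "edge Blue yB M x1" if "M \<in> {M0, m1}" for M
  proof (rule ccontr)
    assume "\<not> edge Blue yB M x1"
    then have "edge Red yB M x1" using that cM edge_Red by auto
    from closedI[OF path.step[of y1 "edge Red", OF cards(1) yM2 path.step[of yB "edge Red", OF cards(3) this p0]] yMo]
      blue_y2_q'
    show False by (rule no_better)
      (use count that in \<open>auto simp: bl0 T_def intro!: packing_mono[OF okT]\<close>)
  qed
  have y2x1: "edge Blue y2 M0 x1"
    by (rule insertion[OF ce0 link Mo(1) M2]) (rule packing_mono[OF okM], simp)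
  \<comment> \<open>Otherwise \<open>y1 M2 yB\<close> replaces \<open>x1\<close> on the red cycle,
    and \<open>x1\<close> prolongs the blue path at \<open>y2\<close>: the red cycle still gains one
    block.\<close>
  have d: "edge Blue yB M1 x2"
  proof (rule ccontr)
    assume "\<not> edge Blue yB M1 x2"
    then have "edge Red yB M1 x2" using cM edge_Red by auto
    from closedI[OF path.step[of y1 "edge Red", OF cards(1) yM2 path.step[of yB "edge Red", OF cards(3) this p1]] yMo]
      path.step[of x1 "edge Blue", OF cx1 edge_sym[OF y2x1] blue_y2_q']
    show False by (rule no_better)
      (use count A in \<open>auto simp: T_def intro!: packing_mono[OF okT]\<close>)
  qed
  have "path (edge Blue) (Suc (Suc (Suc (Suc b)))) x1 (add_mset x1 (add_mset M2
      (add_mset y1 (add_mset m1 (add_mset yB (add_mset m' (add_mset y2 (add_mset m2 Q)))))))) yB"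
    using cx1 edge_sym[OF a[of M2]] blue_y1_yB by (intro path.step) auto
  from closedI[OF this b[of M0]]
  have clx1: "closed Blue (Suc (Suc (Suc (Suc b)))) (add_mset M0 (add_mset x1 (add_mset M2
      (add_mset y1 (add_mset m1 (add_mset yB (add_mset m' (add_mset y2 (add_mset m2 Q)))))))))"
    by simp

  \<comment> \<open>With the blue cycle \<open>clx1\<close>, which has absorbed \<open>x1\<close>, a
    red cycle on the rest would miss one unit; after dropping \<open>x2\<close> as well, it would
    miss two. This forces the first two blue steps.\<close>
  have n1: "n \<noteq> 1" and e: "edge Blue x2 Mo x0"
  proof -
    have False if "n = 1 \<or> edge Red x0 Mo x2"
    proof -
      have "closed Red n (add_mset Mo bl)" unfolding closed_def using p1 Mo(1) that by blast
      from this clx1 show False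
        by (rule no_pair) (use count A in \<open>auto simp: T_def intro!: packing_mono[OF okT]\<close>)
    qed
    then show "n \<noteq> 1" "edge Blue x2 Mo x0" using Mo(1) edge_Blue edge_sym by blast+
  qed
  obtain S x3 bl1 n1 where n: "n = Suc n1" and s: "cedge x2 S x3"
    and p2: "path cedge n1 x3 bl1 x0" and bl: "bl = add_mset x2 (add_mset S bl1)" and cx2: "card x2 = l"
    using path_peel[OF p1c n1] by metis
  have p2r: "path (edge Red) n1 x3 bl1 x0" using cedge_red p2 by (rule path_mono)
  have cS: "card S = r" using cedge_red[OF s] by (rule edge_card)
  have n1': "n1 \<noteq> 1" and blue03: "edge Blue x0 S x3"
  proof -
    have False if "n1 = 1 \<or> edge Red x0 S x3"
    proof -
      have "closed Red n1 (add_mset S bl1)"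
        unfolding closed_def using p2r cS that by blast
      from this clx1 show False
        by (rule no_pair) (use count A n in \<open>auto simp: T_def bl intro!: packing_mono[OF okT]\<close>)
    qed
    then show "n1 \<noteq> 1" "edge Blue x0 S x3" using cS edge_Blue by blast+
  qed
  obtain S2 v bl2 n2 where n1: "n1 = Suc n2" and s2: "cedge x0 S2 v"
    and p3: "path cedge n2 v bl2 x3" and bl1: "bl1 = add_mset x0 (add_mset S2 bl2)"
    using path_peel[OF cedge_path_rev[OF p2] n1'] by metis
  have p3r: "path (edge Red) n2 v bl2 x3" using cedge_red p3 by (rule path_mono)
  have cS2: "card S2 = r" using cedge_red[OF s2] by (rule edge_card)
  have cx3: "card x3 = l" using path_end[OF p3] by simp
  have blue_x2: "path (edge Blue) (Suc (Suc (Suc b))) y2 (add_mset x2 (add_mset M1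
      (add_mset yB (add_mset m' (add_mset y2 (add_mset m2 Q)))))) x2"
    using blue_y2_yB d cx2 by (rule path_snoc)
  \<comment> \<open>Now \<open>clx1\<close> would miss three units. Instead, blue cycles of
    \<open>b + 5\<close> blocks are excluded, which makes \<open>x0 M2 y1 Mo x2\<close> red; this
    detour returns \<open>x0\<close> and \<open>x2\<close> to the red cycle, and \<open>x1\<close>
    closes the blue path from \<open>y2\<close> to \<open>yB\<close>.\<close>
  have n2: "n2 \<noteq> 1" and blue3v: "edge Blue x3 S2 v"
  proof -
    have False if "n2 = 1 \<or> edge Red x3 S2 v"
    proof -
      have cl: "closed Red n2 (add_mset S2 bl2)" unfolding closed_def using p3r cS2 that by blast
      have "edge Red x0 M2 y1"
      proof (rule ccontr)
        assume "\<not> edge Red x0 M2 y1"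
        then have "edge Blue x0 M2 y1" using M2 edge_Blue by blast
        from closedI[OF path.step[of y1 "edge Blue", OF cards(1) e1 path_snoc[OF blue_x2 e cx0]] this]
        show False by (rule no_pair[OF cl])
          (use count A n n1 in \<open>auto simp: T_def bl bl1 intro!: packing_mono[OF okT]\<close>)
      qed
      moreover have "edge Red y1 Mo x2"
      proof (rule ccontr)
        assume "\<not> edge Red y1 Mo x2"
        then have "edge Blue x2 Mo y1" using Mo edge_Blue edge_sym by blast
        from closedI[OF path.step[of y1 "edge Blue", OF cards(1) a[of m1] path.step[of x1 "edge Blue", OF cx1 edge_sym[OF y2x1] blue_x2]] this]
        show False by (intro no_pair[OF cl])
          (use count A n n1 in \<open>auto simp: T_def bl bl1 intro!: packing_mono[OF okT]\<close>)
      qed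
      ultimately have "path (edge Red) (Suc (Suc (Suc n2))) x2
          (add_mset x2 (add_mset Mo (add_mset y1 (add_mset M2 (add_mset x0 (add_mset S2 bl2)))))) x3"
        using path.step[of x2 "edge Red" Mo y1, OF cx2 _ path.step[of y1 "edge Red" M2 x0, OF cards(1) _
            path.step[of x0 "edge Red", OF cx0 cedge_red[OF s2] p3r]]] edge_sym by blast
      from closedI[OF this edge_sym[OF cedge_red[OF s]]]
        closedI[OF path_snoc[OF blue_y2_yB b[of m1] cx1] edge_sym[OF y2x1]]
      show False
        by (rule no_pair) (use count A n n1 in \<open>auto simp: T_def bl bl1 intro!: packing_mono[OF okT]\<close>)
    qed
    then show "n2 \<noteq> 1" "edge Blue x3 S2 v" using cS2 edge_Blue by blast+
  qed
  obtain S3 v' bl3 n3 where n2': "n2 = Suc n3" and s3: "cedge x3 S3 v'"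
    and p4: "path cedge n3 v' bl3 v" and bl2: "bl2 = add_mset x3 (add_mset S3 bl3)"
    using path_peel[OF cedge_path_rev[OF p3] n2] by metis
  have x1': "edge Blue y1 m1 x1" by (rule a) simp
  show False
  proof (rule zigzag_end[OF blue_x2 e blue03 blue3v cedge_path_rev[OF p4] s3 s2 cedge_sym[OF s]
        x1' edge_sym[OF y2x1] cx1 M2 Mo(1) okM])
    show "N = Suc (Suc (Suc b)) + n3 + 5" using count A n n1 n2' by simp
    show "packing (add_mset x2 (add_mset M1 (add_mset yB (add_mset m' (add_mset y2 (add_mset m2 Q))))) + bl3 +
        {#Mo, x0, S, x3, S2, S3, y1, m1, x1, M0, M2#})"
      by (rule packing_mono[OF okT]) (simp add: T_def bl bl1 bl2)
  qed
qed

text \<open>If both ends of the blue path see the red cycle only in blue, the path can be prolonged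
  by a cycle block and eat on. Its end is then always a cycle block, so it closes up to
  \<open>y1\<close> whenever the zigzag stops.\<close>

lemma some_red_link:
  assumes y1: "\<And>M x m x'. cedge x m x' \<Longrightarrow> card M = r \<Longrightarrow> packing (add_mset M (K + blue_blocks)) \<Longrightarrow> edge Blue y1 M x"
    and yB: "\<And>M x m x'. cedge x m x' \<Longrightarrow> card M = r \<Longrightarrow> packing (add_mset M (K + blue_blocks)) \<Longrightarrow> edge Blue yB M x"
  shows False
proof -
  obtain M where M: "card M = r" "packing (add_mset M (K + blue_blocks))" by (rule obtain_free)
  obtain M' where M': "card M' = r" and okM: "packing (add_mset M' (add_mset M (K + blue_blocks)))"
    using obtain_free2[OF M] by metis
  have okM': "packing (add_mset M' (K + blue_blocks))" by (rule packing_mono[OF okM]) simp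
  have A1: "A \<noteq> 1" using A2 by simp
  obtain x0 M0 x1 bl0 where p0: "path (edge Red) A x1 bl0 x0" and K0: "K = add_mset M0 bl0"
    and r0: "edge Red x0 M0 x1"
    using closed_K A1 unfolding closed_def by blast
  then have ce0: "cedge x0 M0 x1" unfolding cedge_def by blast
  obtain M1 x2 bl n where A: "A = Suc n" "0 < n" and r1: "edge Red x1 M1 x2"
    and p1: "path (edge Red) n x2 bl x0" and bl0: "bl0 = add_mset x1 (add_mset M1 bl)" and cx1: "card x1 = l"
    using path_peel[OF p0 A1] by metis
  have K: "K = bl + {#M0, x1, M1#}" by (simp add: K0 bl0 add_mset_commute)
  define T where "T = bl + {#M0, x1, M1#} + Q + {#y1, m1, y2, m2, m', yB, M, M'#}"
  have okT: "packing T" using okM unfolding T_def K by (simp add: add_mset_commute)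
  have p1c: "path cedge n x2 bl x0"
    by (rule path_cedge[OF p1 path.single[OF cx1] r1 r0]) (simp_all add: A K add_mset_commute)
  have c1: "card M1 = r" using r1 by (rule edge_card)
  have "path (edge Blue) (Suc (Suc (Suc (Suc b)))) x1 (add_mset x1 (add_mset M
      (add_mset y1 (add_mset m1 (add_mset yB (add_mset m' (add_mset y2 (add_mset m2 Q)))))))) yB"
    using cx1 edge_sym[OF y1[OF cedge_sym[OF ce0] M]] blue_y1_yB by (rule path.step)
  from closedI[OF this yB[OF cedge_sym[OF ce0] M' okM']]
  have clx1: "closed Blue (Suc (Suc (Suc (Suc b)))) (add_mset M' (add_mset x1 (add_mset M
      (add_mset y1 (add_mset m1 (add_mset yB (add_mset m' (add_mset y2 (add_mset m2 Q)))))))))" .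
  have n1: "n \<noteq> 1" and e: "edge Blue x2 M1 x0"
  proof -
    have False if "n = 1 \<or> edge Red x0 M1 x2"
    proof -
      have "closed Red n (add_mset M1 bl)" unfolding closed_def using p1 c1 that by blast
      from this clx1 show False
        by (rule no_pair) (use count A in \<open>auto simp: T_def intro!: packing_mono[OF okT]\<close>)
    qed
    then show "n \<noteq> 1" "edge Blue x2 M1 x0" using c1 edge_Blue edge_sym by blast+
  qed
  obtain S x3 bl1 n1 where n: "n = Suc n1" and s: "cedge x2 S x3"
    and p2: "path cedge n1 x3 bl1 x0" and bl: "bl = add_mset x2 (add_mset S bl1)" and cx2: "card x2 = l"
    using path_peel[OF p1c n1] by metis
  have blue_x2: "path (edge Blue) (Suc (Suc (Suc (Suc b)))) y1 (add_mset x2 (add_mset M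
      (add_mset y1 (add_mset m1 (add_mset yB (add_mset m' (add_mset y2 (add_mset m2 Q)))))))) x2"
    (is "path _ ?a _ ?Y _")
    using blue_y1_yB yB[OF s M] cx2 by (rule path_snoc)
  have good: "edge Blue y1 M' x" if "cedge x m x'" for x m x'
    using y1[OF that M' okM'] .
  let ?X = "add_mset S (add_mset M1 (?Y + bl1))"
  have okX: "packing (add_mset M' ?X)" by (rule packing_mono[OF okT]) (simp add: T_def bl)
  \<comment> \<open>Besides the unit missing from the start only \<open>x1\<close> is left out, so
    any way of stopping misses two units.\<close>
  have num: "?a + n1 + 2 = N" using count A n by simp
  show False
  proof (rule zigzag[where R = cedge and P = "edge Blue y1 M'", OF _ _ _ blue_x2 good[OF s] e
        cedge_path_rev[OF p2] good[OF ce0] edge_card[OF cedge_red[OF s]]])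
    fix a' A' w' p' J
    assume *: "path (edge Blue) a' y1 A' w'" "edge Blue y1 M' w'" "closed Red p' J"
      "a' + p' = ?a + n1" "A' + J \<subseteq># ?X"
    have "closed Blue a' (add_mset M' A')" using *(1) edge_sym[OF *(2)] by (rule closedI)
    from *(3) this show False
    proof (rule no_pair)
      show "N \<le> p' + a' + 2" using *(4) num by simp
      have "add_mset M' (A' + J) \<subseteq># add_mset M' ?X" using *(5) by (simp only: mset_subset_eq_add_mset_cancel)
      then show "packing (J + add_mset M' A')" using packing_mono[OF okX] by (simp add: union_commute)
    qed
  next
    fix A' w' assume *: "path (edge Blue) (?a + n1) y1 A' w'" "edge Blue y1 M' w'" "A' \<subseteq># ?X"
    have "closed Blue (?a + n1) (add_mset M' A')" using *(1) edge_sym[OF *(2)] by (rule closedI)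
    moreover have "add_mset M' A' \<subseteq># add_mset M' ?X" using *(3) by (simp only: mset_subset_eq_add_mset_cancel)
    then have "packing (add_mset M' A')" by (rule packing_mono[OF okX])
    moreover have "N \<le> ?a + n1 + 4" using num by simp
    ultimately show False using covers_closed_single not_covers by blast
  next
    show "edge Red x m y" if "cedge x m y" for x m y using that by (rule cedge_red)
    show "cedge y m x" if "cedge x m y" for x m y using that by (rule cedge_sym)
    show "edge Blue y1 M' x" if "cedge x m y" for x m y using that by (rule good)
  qed
qed

end

section \<open>Choice of the longest red cycle and conclusion\<close>

context cover_setup begin

lemma extremal_decomposition:
  assumes nc: "\<not> covers 3 V" and conf: "config A K B y P z"
    and max: "\<forall>A' K' B' y Y z. config A' K' B' y Y z \<longrightarrow> A' \<le> A"
  obtains b Q m1 y2 m2 q q' m' where "extremal l r N V c A b K Q y m1 y2 m2 q q' m' z"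
    "P = Q + {#y, m1, y2, m2, m', z#}"
proof -
  have c: "2 \<le> A" "closed Red A K" "path (edge Blue) B y P z" "A + B + 1 = N" "packing (K + P)"
    using conf by (auto simp: config_def)
  have "packing K" using c(5) by (auto elim: packing_mono)
  \<comment> \<open>With at most three blue blocks the red cycle alone would miss at most four
    units. Four blocks leave a nonempty middle part after \<open>y\<close>, \<open>y2\<close> and
    \<open>z\<close> are split off.\<close>
  then have B: "4 \<le> B" using covers_closed_single[OF c(2)] nc c(4) by force
  then have "B \<noteq> 1" by simp
  then obtain m1 y2 P1 B1 where 1: "B = Suc B1" "edge Blue y m1 y2" "path (edge Blue) B1 y2 P1 z"
    "P = add_mset y (add_mset m1 P1)" "card y = l"
    using path_peel[OF c(3)] by metis
  have "B1 \<noteq> 1" using B 1 by simp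
  then obtain m2 q P2 B2 where 2: "B1 = Suc B2" "edge Blue y2 m2 q" "path (edge Blue) B2 q P2 z"
    "P1 = add_mset y2 (add_mset m2 P2)" "card y2 = l"
    using path_peel[OF 1(3)] by metis
  have "B2 \<noteq> 1" using B 1 2 by simp
  then obtain m' q' Q b where 3: "B2 = Suc b" "edge Blue z m' q'" "path (edge Blue) b q' Q q"
    "P2 = add_mset z (add_mset m' Q)" "card z = l"
    using path_peel[OF edge_path_rev[OF 2(3)]] by metis
  have P: "P = Q + {#y, m1, y2, m2, m', z#}" by (simp add: 1(4) 2(4) 3(4) add_mset_commute)
  have "extremal l r N V c A b K Q y m1 y2 m2 q q' m' z"
  proof
    show "packing (K + Q + {#y, m1, y2, m2, m', z#})" using c(5) by (simp add: P)
    show "A + b + 4 = N" using c(4) 1(1) 2(1) 3(1) by simp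
    show "path (edge Blue) b q Q q'" using 3(3) by (rule edge_path_rev)
    show "edge Blue q' m' z" using 3(2) by (rule edge_sym)
    show "A' \<le> A" if "config A' K' B' y Y z" for A' K' B' y Y z using max that by blast
  qed (fact nc c(1,2) 1(2,5) 2(2,5) 3(5))+
  then show thesis using that P by blast
qed

lemma covers_three: "covers 3 V"
proof (rule ccontr)
  assume nc: "\<not> covers 3 V"
  have N: "5 \<le> N"
  proof (rule ccontr)
    assume "\<not> 5 \<le> N"
    then have "covers 2 V" using card_V by (intro covers_le_four_units[of _ N]) auto
    then show False using nc covers_mono[of 2 V 3] by simp
  qed
  define ex where "ex A \<longleftrightarrow> (\<exists>K B y P z. config A K B y P z)" for A
  have ex: "\<exists>A. ex A" using config_exists[OF nc N] by (auto simp: ex_def)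
  have bound: "A \<le> N" if "ex A" for A using that by (auto simp: ex_def config_def)
  define A where "A = (GREATEST A. ex A)"
  have "ex A" unfolding A_def using ex bound by (rule GreatestI_ex_nat)
  have max: "A' \<le> A" if "ex A'" for A' unfolding A_def using that bound by (rule Greatest_le_nat)
  from \<open>ex A\<close> have "\<exists>K B y P z. config A K B y P z" by (simp only: ex_def)
  then obtain K B y P z where conf: "config A K B y P z" by blast
  have max': "\<forall>A' K' B' y Y z. config A' K' B' y Y z \<longrightarrow> A' \<le> A"
    using max unfolding ex_def by blast
  obtain b Q m1 y2 m2 q q' m' where ext: "extremal l r N V c A b K Q y m1 y2 m2 q q' m' z"
    and P: "P = Q + {#y, m1, y2, m2, m', z#}"
    using extremal_decomposition[OF nc conf max'] by metis
  \<comment> \<open>Reversing the blue path keeps the configuration, and \<open>cedge\<close>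
    depends on the red cycle only; so \<open>no_red_link\<close> applies at both ends and
    contradicts \<open>some_red_link\<close>.\<close>
  have "config A K B z P y" using conf edge_path_rev by (auto simp: config_def)
  from extremal_decomposition[OF nc this max']
  obtain b' R n1 z2 n2 p p' n' where ext': "extremal l r N V c A b' K R z n1 z2 n2 p p' n' y"
    and P': "P = R + {#z, n1, z2, n2, n', y#}"
    by metis
  show False
  proof (rule extremal.some_red_link[OF ext])
    fix M x m x'
    assume ce: "extremal.cedge l r c A K x m x'" and M: "card M = r"
      and packing: "packing (add_mset M (K + (Q + {#y, m1, y2, m2, m', z#})))"
    have "\<not> edge Red y M x"
      using extremal.no_red_link[OF ext ce M packing] by blast
    then show "edge Blue y M x" using M edge_Blue by blast
    have "packing (add_mset M (K + (R + {#z, n1, z2, n2, n', y#})))" using packing by (simp only: P[symmetric] P'[symmetric])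
    then have "\<not> edge Red z M x"
      using extremal.no_red_link[OF ext' ce M] by blast
    then show "edge Blue z M x" using M edge_Blue by blast
  qed
qed

end

theorem corollary1p3:
  fixes l k n :: nat and V :: "'a set" and c :: "'a set \<Rightarrow> colour"
  assumes "0 < l" and "2 * l \<le> k" and "0 < n" and "(k - l) dvd n"
    and "finite V" and "card V = n"
  shows "mono_cycle_coverable k l V c 4 \<and> (3 * l \<le> k \<longrightarrow> mono_cycle_coverable k l V c 3)"
proof -
  obtain r where k: "k = 2 * l + r" using assms(2) le_Suc_ex by blast
  then have "k - l = l + r" by simp
  then obtain N where "n = N * (l + r)" using assms(4) by (metis dvd_div_mult_self)
  then interpret cover_setup l r N V c
    using assms by unfold_locales auto
  have "covers 3 V" by (rule covers_three)
  moreover from this have "covers 4 V" by (rule covers_mono) simp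
  ultimately show ?thesis using coverable_if_covers k by blast
qed

end
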